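(* Assume $0<\Delta_n\le 1$, $\Delta_n\to0$ and $n\Delta_n\to\infty$ as $n\to\infty$. Let $\theta\in\mathbb R$, $\sigma>0$, $\lambda>0$ and $z=(u,v,w)\in\mathbb R^3$, and set $\theta_n=\theta+\frac{u}{\sqrt{n\Delta_n}}$, $\sigma_n=\sigma+\frac{v}{\sqrt n}$, $\lambda_n=\lambda+\frac{w}{\sqrt{n\Delta_n}}$. Then, as $n\to\infty$, $$\log\frac{p(X^n;(\theta_n,\sigma_n,\lambda_n))}{p(X^n;(\theta,\sigma,\lambda))}\ \xrightarrow{\ \mathcal L(\mathbb P_x^{\theta,\sigma,\lambda})\ }\ z^{\mathsf T}\mathcal N(0,\Gamma(\theta,\sigma,\lambda))-\tfrac12 z^{\mathsf T}\Gamma(\theta,\sigma,\lambda)z,$$ where $\mathcal N(0,\Gamma)$ is a centered Gaussian vector in $\mathbb R^3$ with covariance matrix $$\Gamma(\theta,\sigma,\lambda)=\frac1{\sigma^2}\begin{pmatrix}1&0&-1\\0&2&0\\-1&0&1+\frac{\sigma^2}{\lambda}\end{pmatrix}.$$ That is, the LAN property holds at every $(\theta,\sigma,\lambda)$ with rates $(\sqrt{n\Delta_n},\sqrt n,\sqrt{n\Delta_n})$ and Fisher information $\Gamma(\theta,\sigma,\lambda)$.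
   Context: Let $B$ be a standard Brownian motion and $N$ an independent Poisson process with intensity $\lambda>0$. For $x\in\mathbb R$, $\theta\in\mathbb R$, $\sigma>0$, $\lambda>0$ the process is $X_t=x+\theta t+\sigma B_t+N_t-\lambda t$, $t\ge0$, and $\mathbb P_x^{\theta,\sigma,\lambda}$ denotes its law (the convergence in the claim is convergence in law under this measure). Observation times are $t_k=k\Delta_n$, $k=0,\dots,n$, and $X^n=(X_{t_0},\dots,X_{t_n})$. The transition density is $p^{\theta,\sigma,\lambda}(\Delta,x,y)=\sum_{m\ge0}e^{-\lambda\Delta}\frac{(\lambda\Delta)^m}{m!}(2\pi\sigma^2\Delta)^{-1/2}\exp\!\big(-\frac{(y-x-(\theta-\lambda)\Delta-m)^2}{2\sigma^2\Delta}\big)$ (the density of $x+\theta\Delta+\sigma B_\Delta+N_\Delta-\lambda\Delta$), and the likelihood of the observations is $p(X^n;(\theta,\sigma,\lambda))=\prod_{k=0}^{n-1}p^{\theta,\sigma,\lambda}(\Delta_n,X_{t_k},X_{t_{k+1}})$. *)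

theory Defs
  imports "HOL-Probability.Probability"
begin

definition bm_poisson ::
  "'a measure \<Rightarrow> (real \<Rightarrow> 'a \<Rightarrow> real) \<Rightarrow> (real \<Rightarrow> 'a \<Rightarrow> real) \<Rightarrow> real \<Rightarrow> bool" where
  "bm_poisson M B N lam \<longleftrightarrow>
     prob_space M \<and>
     (\<forall>t. B t \<in> borel_measurable M) \<and> (\<forall>t. N t \<in> borel_measurable M) \<and>
     (AE \<omega> in M. B 0 \<omega> = 0 \<and> N 0 \<omega> = 0) \<and>
     (AE \<omega> in M. continuous_on {0..} (\<lambda>t. B t \<omega>)) \<and>
     (AE \<omega> in M. (\<forall>t\<ge>0. N t \<omega> \<in> \<nat>) \<and> mono_on {0..} (\<lambda>t. N t \<omega>)
                   \<and> (\<forall>t\<ge>0. continuous (at_right t) (\<lambda>s. N s \<omega>))) \<and>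
     (\<forall>s t. 0 \<le> s \<and> s < t \<longrightarrow>
        distr M borel (\<lambda>\<omega>. B t \<omega> - B s \<omega>) = density lborel (normal_density 0 (sqrt (t - s)))) \<and>
     (\<forall>s t. 0 \<le> s \<and> s < t \<longrightarrow> (\<forall>k::nat.
        measure M {\<omega>\<in>space M. N t \<omega> - N s \<omega> = real k}
          = (lam * (t - s)) ^ k / fact k * exp (- lam * (t - s)))) \<and>
     (\<forall>(ts :: nat \<Rightarrow> real) m. 0 \<le> ts 0 \<and> (\<forall>i<m. ts i < ts (Suc i)) \<longrightarrow>
        prob_space.indep_vars M (\<lambda>_. borel)
          (\<lambda>j. case j of
                 Inl i \<Rightarrow> (\<lambda>\<omega>. B (ts (Suc i)) \<omega> - B (ts i) \<omega>)
               | Inr i \<Rightarrow> (\<lambda>\<omega>. N (ts (Suc i)) \<omega> - N (ts i) \<omega>))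
          ({..<m} <+> {..<m}))"

definition trans_dens :: "real \<Rightarrow> real \<Rightarrow> real \<Rightarrow> real \<Rightarrow> real \<Rightarrow> real \<Rightarrow> real" where
  "trans_dens \<theta> \<sigma> lam \<Delta> x y =
     (\<Sum>m. exp (- lam * \<Delta>) * (lam * \<Delta>) ^ m / fact m
            * (1 / sqrt (2 * pi * \<sigma>\<^sup>2 * \<Delta>))
            * exp (- (y - x - (\<theta> - lam) * \<Delta> - real m)\<^sup>2 / (2 * \<sigma>\<^sup>2 * \<Delta>)))"

definition likelihood :: "real \<Rightarrow> real \<Rightarrow> real \<Rightarrow> real \<Rightarrow> nat \<Rightarrow> (nat \<Rightarrow> real) \<Rightarrow> real" where
  "likelihood \<theta> \<sigma> lam \<Delta> n xs = (\<Prod>k<n. trans_dens \<theta> \<sigma> lam \<Delta> (xs k) (xs (Suc k)))"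

definition Fisher :: "real \<Rightarrow> real \<Rightarrow> nat \<Rightarrow> nat \<Rightarrow> real" where
  "Fisher \<sigma> lam i j = (1 / \<sigma>\<^sup>2) *
     (if i = 0 \<and> j = 0 then 1
      else if i = 0 \<and> j = 2 then -1
      else if i = 2 \<and> j = 0 then -1
      else if i = 1 \<and> j = 1 then 2
      else if i = 2 \<and> j = 2 then 1 + \<sigma>\<^sup>2 / lam
      else 0)"

definition quad_form :: "(nat \<Rightarrow> nat \<Rightarrow> real) \<Rightarrow> (nat \<Rightarrow> real) \<Rightarrow> real" where
  "quad_form G z = (\<Sum>i<3. \<Sum>j<3. z i * G i j * z j)"

text \<open>Law of z^T N(0,Gamma) - z^T Gamma z / 2, i.e. of sqrt q * G - q/2 with G standard
  normal and q = z^T Gamma z (z^T N(0,Gamma) is N(0,q); for q = 0 a point mass).\<close>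
definition lan_limit_law :: "real \<Rightarrow> real measure" where
  "lan_limit_law q = distr (density lborel std_normal_density) borel (\<lambda>g. sqrt q * g - q / 2)"

end

theory Submission
  imports Defs "HOL-Real_Asymp.Real_Asymp"
begin

text \<open>
  For fixed n the increments are i.i.d., so by Levy's continuity theorem it suffices to show
  n (E exp (i t ln r) - 1) \<longlonglongrightarrow> - (t^2 + i t) q / 2, where r is the ratio of the two transition
  densities at one increment and q the quadratic form of the Fisher information. Since E r = 1, the term linear in r - 1 drops out of E exp (i t ln r), and the
  limit only depends on second moments of r - 1.

  The increment is a function of the unobserved pair (g, m) of the normalised Gaussian part and
  the number of jumps, and r is the conditional expectation, given the increment, of the explicit
  likelihood ratio of this pair. In L2, with errors o(1/n), the latter minus one is the
  score S of the complete experiment, for which n E S^2 = q and n E S^4 \<longlonglongrightarrow> 0. Rounding the increment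
  to the nearest integer recovers m unless the Gaussian part exceeds 1/2, so S is, again up to
  o(1/n), a function of the increment. As conditional expectation is an L2 contraction fixing such
  functions, r - 1 is close to S as well.
\<close>

section \<open>Second-order expansion of the characteristic function of a log-ratio\<close>

text \<open>The transition density is an infinite mixture; its logarithmic derivatives are never
  formed. All computations concern the pair (g, m), whose likelihood ratio is a product with
  explicit moments, and only an L2 bound is carried over to r. Normalising by the true parameters
  turns the perturbation into a shift (u - w) / (\<sigma> sqrt n) of g, a scaling of g by 1 + v /
  (\<sigma> sqrt n), and a Poisson mean \<lambda> \<Delta> + w sqrt (\<Delta> / n). Because the
  jumps are compensated, the drift parameter is \<theta> - \<lambda>: this is why u and w enter the
  shift together, and it is the origin of the entries -1 of the Fisher matrix. The hypotheses on the
  step act in different places. The rounding error is negligible because \<Delta> tends to 0; and n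
  E S^4 vanishes because n \<Delta> tends to infinity, since the rare jumps contribute a term of
  order 1 / (n \<Delta>) to it.\<close>

lemma iexp_ln_second_order:
  "((\<lambda>D. (iexp (t * ln (1 + D)) - 1 - \<i> * of_real (t * D)) / of_real (D\<^sup>2)) \<longlongrightarrow> - (of_real (t\<^sup>2) + \<i> * of_real t) / 2)
     (at (0::real))"
proof -
  \<comment> \<open>The limit is it (it - 1) / 2, the coefficient of D^2 in (1 + D)^(it); it
    vanishes at t = -i, in accordance with E r = 1. Real and imaginary parts are treated separately
    because \<open>real_asymp\<close> works with real functions.\<close>
  have re: "((\<lambda>D. (cos (t * ln (1 + D)) - 1) / D\<^sup>2) \<longlongrightarrow> - t\<^sup>2 / 2) (at (0::real))"
    by (real_asymp; simp add: power2_eq_square)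
  \<comment> \<open>The case s = 0 is split off because the leading coefficient then vanishes; for
    the rest \<open>real_asymp\<close> is given the sign of s.\<close>
  have "((\<lambda>D. (sin (s * ln (1 + D)) - s * D) / D\<^sup>2) \<longlongrightarrow> - s / 2) (at (0::real))"
    if "s \<noteq> 0" for s :: real
    using that unfolding neq_iff by (elim disjE; real_asymp)
  hence im: "((\<lambda>D. (sin (t * ln (1 + D)) - t * D) / D\<^sup>2) \<longlongrightarrow> - t / 2) (at (0::real))"
    by (cases "t = 0") auto
  have "((\<lambda>D. Complex ((cos (t * ln (1 + D)) - 1) / D\<^sup>2) ((sin (t * ln (1 + D)) - t * D) / D\<^sup>2)) \<longlongrightarrow>
         Complex (- t\<^sup>2 / 2) (- t / 2)) (at (0::real))"
    by (rule tendsto_Complex[OF re im])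
  also have "Complex (- t\<^sup>2 / 2) (- t / 2) = - (of_real (t\<^sup>2) + \<i> * of_real t) / 2"
    by (simp add: complex_eq_iff)
  also have "(\<lambda>D. Complex ((cos (t * ln (1 + D)) - 1) / D\<^sup>2) ((sin (t * ln (1 + D)) - t * D) / D\<^sup>2)) =
      (\<lambda>D. (iexp (t * ln (1 + D)) - 1 - \<i> * of_real (t * D)) / of_real (D\<^sup>2))"
    by (intro ext) (simp add: complex_eq_iff Re_exp Im_exp Re_divide_of_real Im_divide_of_real del: of_real_power)
  finally show ?thesis .
qed

text \<open>Half of D is dominated in absolute value by D - S or by S. In the second case S is at
  least \<delta> / 2 in absolute value, so 4 S^2 is at most (16 / \<delta>^2) S^4. Large values of D
  are thus charged to D - S and to the fourth moment of S, and no moment of D beyond the second is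
  called for.\<close>

lemma large_deviation_square_bound:
  fixes D S \<delta> :: real
  assumes "\<delta> > 0" "\<delta> \<le> \<bar>D\<bar>"
  shows "D\<^sup>2 \<le> 4 * (D - S)\<^sup>2 + 16 / \<delta>\<^sup>2 * S ^ 4"
proof (cases "\<bar>S\<bar> \<le> \<bar>D - S\<bar>")
  case True
  hence "\<bar>D\<bar> \<le> \<bar>2 * (D - S)\<bar>" by (simp add: abs_mult)
  hence "D\<^sup>2 \<le> 4 * (D - S)\<^sup>2" by (simp only: abs_le_square_iff power_mult_distrib) simp
  moreover have "0 \<le> 16 / \<delta>\<^sup>2 * S ^ 4" by simp
  ultimately show ?thesis by linarith
next
  case False
  hence "\<bar>D\<bar> \<le> \<bar>2 * S\<bar>" "\<bar>\<delta>\<bar> \<le> \<bar>2 * S\<bar>" using assms by (simp_all add: abs_mult)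
  hence *: "D\<^sup>2 \<le> 4 * S\<^sup>2" "\<delta>\<^sup>2 \<le> 4 * S\<^sup>2" by (simp_all only: abs_le_square_iff power_mult_distrib) simp_all
  have "4 * S\<^sup>2 * \<delta>\<^sup>2 \<le> 4 * S\<^sup>2 * (4 * S\<^sup>2)"
    using * by (intro mult_left_mono) auto
  hence "4 * S\<^sup>2 \<le> 16 / \<delta>\<^sup>2 * S ^ 4"
    using assms(1) by (simp add: field_simps power4_eq_xxxx power2_eq_square)
  with * show ?thesis using zero_le_power2[of "D - S"] by linarith
qed

text \<open>For small D the Taylor limit applies; for large D the whole remainder is at most a
  multiple of D^2, which the preceding lemma absorbs. Then D^2 is traded for S^2. Beyond a small
  multiple of S^2, only terms remain whose integrals are o(1/n) in the application.\<close>

lemma iexp_ln_second_order_bound: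
  fixes t \<epsilon> :: real
  assumes "\<epsilon> > 0"
  obtains K where "K \<ge> 0" "\<And>D S. D > -1 \<Longrightarrow>
    cmod (iexp (t * ln (1 + D)) - 1 - \<i> * of_real (t * D) + (of_real (t\<^sup>2) + \<i> * of_real t) / 2 * of_real (S\<^sup>2))
      \<le> \<epsilon> * S\<^sup>2 + K * ((D - S)\<^sup>2 + S ^ 4)"
proof -
  define c where "c = - (of_real (t\<^sup>2) + \<i> * of_real t) / 2"
  define g where "g D = iexp (t * ln (1 + D)) - 1 - \<i> * of_real (t * D)" for D :: real
  have "eventually (\<lambda>D. dist (g D / of_real (D\<^sup>2)) c < \<epsilon> / 4) (at 0)"
    using tendstoD[OF iexp_ln_second_order, of "\<epsilon>/4" t] assms unfolding g_def c_def by simp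
  then obtain \<delta> where \<delta>: "\<delta> > 0" and near: "\<And>D. D \<noteq> 0 \<Longrightarrow> \<bar>D\<bar> < \<delta> \<Longrightarrow> cmod (g D / of_real (D\<^sup>2) - c) < \<epsilon> / 4"
    unfolding eventually_at dist_norm by auto
  \<comment> \<open>For |D| \<ge> \<delta> one has 1 \<le> D^2 / \<delta>^2 and |D| \<le> D^2 /
    \<delta>, which turns the crude bound 2 + |t| |D| + |c| D^2 into a multiple of D^2.\<close>
  define K1 where "K1 = 2 / \<delta>\<^sup>2 + \<bar>t\<bar> / \<delta> + cmod c"
  \<comment> \<open>The weight in Young's inequality for the cross term of D^2 - S^2 = (D - S)^2 + 2
    S (D - S), small enough that the resulting multiple of S^2 is at most \<epsilon> / 2. The added
    1 covers c = 0.\<close>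
  define \<kappa> where "\<kappa> = \<epsilon> / (2 * (cmod c + 1))"
  have cpos: "cmod c + 1 > 0" using norm_ge_zero[of c] by linarith
  have \<kappa>: "\<kappa> > 0" unfolding \<kappa>_def using assms cpos by simp
  have c\<kappa>: "cmod c * \<kappa> \<le> \<epsilon> / 2"
    unfolding \<kappa>_def using assms cpos by (simp add: field_simps)
  have K1: "K1 \<ge> 0" unfolding K1_def using \<delta> by simp
  define K where "K = \<epsilon> / 2 + 4 * K1 + 16 * K1 / \<delta>\<^sup>2 + cmod c * (1 + 1 / \<kappa>)"
  have K: "K \<ge> 0" unfolding K_def using K1 \<kappa> assms by simp
  have "cmod (g D - c * of_real (S\<^sup>2)) \<le> \<epsilon> * S\<^sup>2 + K * ((D - S)\<^sup>2 + S ^ 4)" for D S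
  proof -
    let ?R = "K1 * (4 * (D - S)\<^sup>2 + 16 / \<delta>\<^sup>2 * S ^ 4)"
    have R: "?R \<ge> 0" using K1 by simp
    have "cmod (g D - c * of_real (D\<^sup>2)) \<le> \<epsilon> / 4 * D\<^sup>2 + ?R"
    proof (cases "\<bar>D\<bar> < \<delta>")
      case True
      have "cmod (g D - c * of_real (D\<^sup>2)) \<le> \<epsilon> / 4 * D\<^sup>2"
      proof (cases "D = 0")
        case True thus ?thesis by (simp add: g_def)
      next
        case False
        hence "g D - c * of_real (D\<^sup>2) = (g D / of_real (D\<^sup>2) - c) * of_real (D\<^sup>2)"
          by (simp add: field_simps)
        also have "cmod \<dots> = cmod (g D / of_real (D\<^sup>2) - c) * D\<^sup>2"
          by (simp only: norm_mult norm_of_real abs_power2)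
        also have "\<dots> \<le> \<epsilon> / 4 * D\<^sup>2"
          using near[OF False True] by (intro mult_right_mono) auto
        finally show ?thesis .
      qed
      with R show ?thesis by linarith
    next
      case False
      hence D: "\<delta> \<le> \<bar>D\<bar>" by simp
      have "cmod (g D) \<le> cmod (iexp (t * ln (1 + D)) - 1) + cmod (\<i> * of_real (t * D))"
        unfolding g_def by (rule norm_triangle_ineq4)
      also have "\<dots> \<le> (1 + 1) + \<bar>t\<bar> * \<bar>D\<bar>"
        using norm_triangle_ineq4[of "iexp (t * ln (1 + D))" 1]
        by (simp add: norm_mult abs_mult)
      finally have "cmod (g D - c * of_real (D\<^sup>2)) \<le> 2 + \<bar>t\<bar> * \<bar>D\<bar> + cmod c * D\<^sup>2"
        using norm_triangle_ineq4[of "g D" "c * of_real (D\<^sup>2)"] by (simp add: norm_mult norm_power)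
      also have "\<dots> \<le> K1 * D\<^sup>2"
      proof -
        have "\<delta>\<^sup>2 \<le> D\<^sup>2" using D \<delta> by (metis abs_le_square_iff abs_of_pos)
        hence "2 \<le> 2 / \<delta>\<^sup>2 * D\<^sup>2" using \<delta> by (simp add: field_simps)
        moreover have "\<bar>D\<bar> * \<delta> \<le> \<bar>D\<bar> * \<bar>D\<bar>" using D by (intro mult_left_mono) auto
        hence "\<bar>t\<bar> * (\<bar>D\<bar> * \<delta>) \<le> \<bar>t\<bar> * D\<^sup>2" by (intro mult_left_mono) (auto simp: power2_eq_square)
        hence "\<bar>t\<bar> * \<bar>D\<bar> \<le> \<bar>t\<bar> / \<delta> * D\<^sup>2" using \<delta> by (simp add: field_simps)
        ultimately show ?thesis unfolding K1_def by (simp add: algebra_simps)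
      qed
      also have "\<dots> \<le> ?R"
        using large_deviation_square_bound[OF \<delta> D, of S] K1 by (intro mult_left_mono) auto
      finally have "cmod (g D - c * of_real (D\<^sup>2)) \<le> ?R" .
      moreover have "0 \<le> \<epsilon> / 4 * D\<^sup>2" using assms by simp
      ultimately show ?thesis by linarith
    qed
    \<comment> \<open>Here \<epsilon> / 4 doubles to \<epsilon> / 2; the other half of \<epsilon> is
      reserved for the term governed by \<open>\<kappa>\<close>.\<close>
    also have "\<epsilon> / 4 * D\<^sup>2 \<le> \<epsilon> / 4 * (2 * S\<^sup>2 + 2 * (D - S)\<^sup>2)"
    proof (rule mult_left_mono)
      have "0 \<le> (D - 2 * S)\<^sup>2" by simp
      thus "D\<^sup>2 \<le> 2 * S\<^sup>2 + 2 * (D - S)\<^sup>2" by (simp add: power2_eq_square algebra_simps)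
    qed (use assms in auto)
    finally have 1: "cmod (g D - c * of_real (D\<^sup>2)) \<le> \<epsilon> / 2 * S\<^sup>2 + \<epsilon> / 2 * (D - S)\<^sup>2 + ?R"
      by (simp add: algebra_simps)
    have "\<bar>D\<^sup>2 - S\<^sup>2\<bar> \<le> \<kappa> * S\<^sup>2 + (1 + 1 / \<kappa>) * (D - S)\<^sup>2"
    proof -
      have "0 \<le> (\<kappa> * S - (D - S))\<^sup>2 / \<kappa>" "0 \<le> (\<kappa> * S + (D - S))\<^sup>2 / \<kappa>" using \<kappa> by simp_all
      moreover have "(\<kappa> * S - (D - S))\<^sup>2 / \<kappa> = \<kappa> * S\<^sup>2 + 1 / \<kappa> * (D - S)\<^sup>2 - 2 * S * (D - S)"
        "(\<kappa> * S + (D - S))\<^sup>2 / \<kappa> = \<kappa> * S\<^sup>2 + 1 / \<kappa> * (D - S)\<^sup>2 + 2 * S * (D - S)"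
        using \<kappa> by (simp_all add: field_simps power2_eq_square)
      moreover have "D\<^sup>2 - S\<^sup>2 = (D - S)\<^sup>2 + 2 * S * (D - S)"
        by (simp add: power2_eq_square algebra_simps)
      moreover have "0 \<le> (D - S)\<^sup>2" by simp
      ultimately show ?thesis unfolding distrib_right by linarith
    qed
    hence "cmod c * \<bar>D\<^sup>2 - S\<^sup>2\<bar> \<le> cmod c * (\<kappa> * S\<^sup>2 + (1 + 1 / \<kappa>) * (D - S)\<^sup>2)"
      by (intro mult_left_mono) auto
    also have "\<dots> = (cmod c * \<kappa>) * S\<^sup>2 + cmod c * (1 + 1 / \<kappa>) * (D - S)\<^sup>2"
      by (simp add: algebra_simps)
    also have "\<dots> \<le> \<epsilon> / 2 * S\<^sup>2 + cmod c * (1 + 1 / \<kappa>) * (D - S)\<^sup>2"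
      using c\<kappa> by (intro add_right_mono mult_right_mono) auto
    finally have 2: "cmod (c * of_real (D\<^sup>2) - c * of_real (S\<^sup>2)) \<le> \<epsilon> / 2 * S\<^sup>2 + cmod c * (1 + 1 / \<kappa>) * (D - S)\<^sup>2"
      by (simp add: right_diff_distrib[symmetric] norm_mult of_real_diff[symmetric] del: of_real_diff of_real_power)
    have "cmod (g D - c * of_real (S\<^sup>2)) \<le> \<epsilon> * S\<^sup>2 + (\<epsilon> / 2 + 4 * K1 + cmod c * (1 + 1 / \<kappa>)) * (D - S)\<^sup>2 + 16 * K1 / \<delta>\<^sup>2 * S ^ 4"
      using norm_triangle_le[of "g D - c * of_real (D\<^sup>2)" "c * of_real (D\<^sup>2) - c * of_real (S\<^sup>2)", OF add_mono[OF 1 2]]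
      by (simp add: algebra_simps)
    also have "\<dots> \<le> \<epsilon> * S\<^sup>2 + K * (D - S)\<^sup>2 + K * S ^ 4"
      using \<delta> K1 assms \<kappa> by (intro add_mono mult_right_mono order_refl) (auto simp: K_def)
    finally show ?thesis by (simp add: algebra_simps)
  qed
  thus ?thesis using that[of K] K unfolding g_def c_def by (simp add: field_simps)
qed

text \<open>\<open>K\<close> is fixed before the probability space, so that the bound is uniform
  over a triangular array whose underlying measure changes from row to row. The linear term
  disappears because \<open>D\<close> has mean zero.\<close>

lemma char_ln_second_order_bound:
  fixes t \<epsilon> :: real
  assumes "\<epsilon> > 0"
  obtains K where "K \<ge> 0" "\<And>(P :: 'b measure) (D :: 'b \<Rightarrow> real) S. \<lbrakk>prob_space P; integrable P D; integral\<^sup>L P D = 0;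
      \<And>x. D x > -1; S \<in> borel_measurable P; integrable P (\<lambda>x. (S x)\<^sup>2); integrable P (\<lambda>x. (S x)^4);
      integrable P (\<lambda>x. (D x - S x)\<^sup>2)\<rbrakk> \<Longrightarrow>
    cmod ((CLINT x|P. iexp (t * ln (1 + D x))) - 1 + (of_real (t\<^sup>2) + \<i> * of_real t) / 2 * of_real (LINT x|P. (S x)\<^sup>2))
      \<le> \<epsilon> * (LINT x|P. (S x)\<^sup>2) + K * ((LINT x|P. (D x - S x)\<^sup>2) + (LINT x|P. (S x)^4))"
proof -
  obtain K where K: "K \<ge> 0" and bnd: "\<And>D S. D > -1 \<Longrightarrow>
    cmod (iexp (t * ln (1 + D)) - 1 - \<i> * of_real (t * D) + (of_real (t\<^sup>2) + \<i> * of_real t) / 2 * of_real (S\<^sup>2))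
      \<le> \<epsilon> * S\<^sup>2 + K * ((D - S)\<^sup>2 + S ^ 4)"
    using iexp_ln_second_order_bound[OF assms, of t] by blast
  show ?thesis
  proof (rule that[OF K])
    fix P :: "'b measure" and D S :: "'b \<Rightarrow> real"
    assume P: "prob_space P" and D: "integrable P D" "integral\<^sup>L P D = 0" "\<And>x. D x > -1"
      and S [measurable]: "S \<in> borel_measurable P"
      and I: "integrable P (\<lambda>x. (S x)\<^sup>2)" "integrable P (\<lambda>x. (S x)^4)" "integrable P (\<lambda>x. (D x - S x)\<^sup>2)"
    interpret prob_space P by fact
    have [measurable]: "D \<in> borel_measurable P" using D(1) by simp
    let ?c = "(of_real (t\<^sup>2) + \<i> * of_real t) / 2 :: complex"
    let ?F = "\<lambda>x. iexp (t * ln (1 + D x)) - 1 - \<i> * of_real (t * D x) + ?c * of_real ((S x)\<^sup>2)"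
    have i1: "integrable P (\<lambda>x. iexp (t * ln (1 + D x)))"
      by (rule integrable_const_bound[where B=1]) auto
    have i2: "complex_integrable P (\<lambda>x. of_real (t * D x))" "complex_integrable P (\<lambda>x. of_real ((S x)\<^sup>2))"
      using D(1) I(1) by (auto intro!: integrable_of_real simp del: of_real_mult of_real_power)
    have "(CLINT x|P. ?F x) = (CLINT x|P. iexp (t * ln (1 + D x))) - 1 - \<i> * (CLINT x|P. of_real (t * D x))
        + ?c * (CLINT x|P. of_real ((S x)\<^sup>2))"
      using i1 i2 by (simp add: prob_space del: of_real_mult of_real_power)
    also have "(CLINT x|P. of_real (t * D x)) = 0"
      using D by (simp only: integral_complex_of_real integral_mult_right_zero) simp
    also have "(CLINT x|P. of_real ((S x)\<^sup>2)) = of_real (LINT x|P. (S x)\<^sup>2)"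
      by (rule integral_complex_of_real)
    finally have eq: "(CLINT x|P. iexp (t * ln (1 + D x))) - 1 + ?c * of_real (LINT x|P. (S x)\<^sup>2) = (CLINT x|P. ?F x)"
      by simp
    have "cmod (CLINT x|P. ?F x) \<le> (LINT x|P. \<epsilon> * (S x)\<^sup>2 + K * ((D x - S x)\<^sup>2 + (S x) ^ 4))"
      by (rule order_trans[OF integral_norm_bound integral_mono])
         (use i1 i2 I bnd[OF D(3)] in \<open>auto simp del: of_real_mult of_real_power\<close>)
    also have "\<dots> = \<epsilon> * (LINT x|P. (S x)\<^sup>2) + K * ((LINT x|P. (D x - S x)\<^sup>2) + (LINT x|P. (S x)^4))"
      using I by simp
    finally show "cmod ((CLINT x|P. iexp (t * ln (1 + D x))) - 1 + ?c * of_real (LINT x|P. (S x)\<^sup>2))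
      \<le> \<epsilon> * (LINT x|P. (S x)\<^sup>2) + K * ((LINT x|P. (D x - S x)\<^sup>2) + (LINT x|P. (S x)^4))"
      unfolding eq .
  qed
qed

section \<open>Poisson and Gaussian moments\<close>

text \<open>Integrability and value are carried together by \<open>has_bochner_integral\<close>, so
  that the moments below are assembled by introduction rules, without separate integrability
  proofs.\<close>

lemma has_bochner_integral_pair_mult:
  fixes f :: "'a \<Rightarrow> real" and k :: "'b \<Rightarrow> real"
  assumes "sigma_finite_measure M1" "sigma_finite_measure M2"
    and f: "has_bochner_integral M1 f I" and k: "has_bochner_integral M2 k J"
  shows "has_bochner_integral (M1 \<Otimes>\<^sub>M M2) (\<lambda>z. f (fst z) * k (snd z)) (I * J)"
proof -
  interpret M1: sigma_finite_measure M1 by fact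
  interpret M2: sigma_finite_measure M2 by fact
  interpret pair_sigma_finite M1 M2 ..
  have [measurable]: "f \<in> borel_measurable M1" "k \<in> borel_measurable M2"
    using f k by (auto simp: has_bochner_integral_iff)
  have fi: "integrable M1 f" "integral\<^sup>L M1 f = I" and ki: "integrable M2 k" "integral\<^sup>L M2 k = J"
    using f k by (auto simp: has_bochner_integral_iff)
  have int: "integrable (M1 \<Otimes>\<^sub>M M2) (\<lambda>z. f (fst z) * k (snd z))"
    by (rule Fubini_integrable) (use fi ki in \<open>auto simp: abs_mult\<close>)
  show ?thesis
    using integral_fst'[OF int] int fi ki by (simp add: has_bochner_integral_iff)
qed

lemma has_bochner_integral_pmf_nat_iff:
  fixes f :: "nat \<Rightarrow> real"
  shows "has_bochner_integral (measure_pmf p) f I \<longleftrightarrow>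
    summable (\<lambda>m. \<bar>pmf p m * f m\<bar>) \<and> (\<lambda>m. pmf p m * f m) sums I"
proof -
  have int: "integrable (measure_pmf p) f \<longleftrightarrow> summable (\<lambda>m. \<bar>pmf p m * f m\<bar>)"
    by (simp add: measure_pmf_eq_density integrable_density integrable_count_space_nat_iff)
  have eq: "(\<lambda>m. pmf p m * f m) sums (integral\<^sup>L (measure_pmf p) f)" if "integrable (measure_pmf p) f"
  proof -
    have "integrable (count_space UNIV) (\<lambda>m. pmf p m * f m)"
      using that unfolding int by (simp add: integrable_count_space_nat_iff)
    from sums_integral_count_space_nat[OF this] show ?thesis
      by (simp add: measure_pmf_eq_density integral_density)
  qed
  show ?thesis
    unfolding has_bochner_integral_iff using int eq sums_unique2 by blast
qed

lemma has_bochner_integral_poisson_power: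
  assumes "\<mu> > 0"
  shows "has_bochner_integral (measure_pmf (poisson_pmf \<mu>)) (\<lambda>m. \<rho> ^ m) (exp (\<mu> * (\<rho> - 1)))"
proof -
  have eq: "pmf (poisson_pmf \<mu>) m * \<rho> ^ m = exp (- \<mu>) * ((\<mu> * \<rho>) ^ m /\<^sub>R fact m)" for m
    using assms by (simp add: power_mult_distrib field_simps)
  have "(\<lambda>m. exp (- \<mu>) * ((\<mu> * \<rho>) ^ m /\<^sub>R fact m)) sums (exp (- \<mu>) * exp (\<mu> * \<rho>))"
    by (intro sums_mult exp_converges)
  moreover have "exp (- \<mu>) * exp (\<mu> * \<rho>) = exp (\<mu> * (\<rho> - 1))"
    by (simp add: exp_add[symmetric] algebra_simps)
  moreover have "summable (\<lambda>m. exp (- \<mu>) * norm ((\<mu> * \<rho>) ^ m /\<^sub>R fact m))"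
    by (intro summable_mult summable_norm_exp)
  ultimately show ?thesis
    unfolding has_bochner_integral_pmf_nat_iff eq by (simp add: abs_mult)
qed

text \<open>The Stein-Chen identity, obtained by shifting the index in m \<mu>^m / m! = \<mu>
  \<mu>^(m-1) / (m-1)!. It raises the degree of a known moment by one and also yields the weighted
  moment of a Poisson likelihood ratio.\<close>

lemma has_bochner_integral_poisson_mult:
  fixes f :: "nat \<Rightarrow> real"
  assumes \<mu>: "\<mu> > 0" and f: "has_bochner_integral (measure_pmf (poisson_pmf \<mu>)) (\<lambda>m. f (Suc m)) I"
  shows "has_bochner_integral (measure_pmf (poisson_pmf \<mu>)) (\<lambda>m. real m * f m) (\<mu> * I)"
proof -
  have eq: "pmf (poisson_pmf \<mu>) (Suc m) * (real (Suc m) * f (Suc m)) = \<mu> * (pmf (poisson_pmf \<mu>) m * f (Suc m))" for m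
    using \<mu> by (simp add: field_simps del: of_nat_Suc)
  from f have 1: "summable (\<lambda>m. \<bar>pmf (poisson_pmf \<mu>) m * f (Suc m)\<bar>)"
    and 2: "(\<lambda>m. pmf (poisson_pmf \<mu>) m * f (Suc m)) sums I"
    unfolding has_bochner_integral_pmf_nat_iff by auto
  have "summable (\<lambda>m. \<bar>pmf (poisson_pmf \<mu>) (Suc m) * (real (Suc m) * f (Suc m))\<bar>)"
    unfolding eq abs_mult[of \<mu>] using 1 by (rule summable_mult)
  moreover have "(\<lambda>m. pmf (poisson_pmf \<mu>) (Suc m) * (real (Suc m) * f (Suc m))) sums (\<mu> * I)"
    unfolding eq using 2 by (rule sums_mult)
  ultimately show ?thesis
    unfolding has_bochner_integral_pmf_nat_iff
    by (subst (asm) summable_Suc_iff, subst (asm) sums_Suc_iff) simp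
qed

lemma poisson_moments:
  assumes "\<mu> > 0"
  defines "P \<equiv> measure_pmf (poisson_pmf \<mu>)"
  shows poisson_centered_moment_1: "has_bochner_integral P (\<lambda>m. real m - \<mu>) 0"
    and poisson_centered_moment_2: "has_bochner_integral P (\<lambda>m. (real m - \<mu>)\<^sup>2) \<mu>"
    and poisson_centered_moment_4: "has_bochner_integral P (\<lambda>m. (real m - \<mu>) ^ 4) (\<mu> + 3 * \<mu>\<^sup>2)"
proof -
  note step = has_bochner_integral_poisson_mult[OF assms(1), folded P_def]
  note add = has_bochner_integral_add and mul = has_bochner_integral_mult_right
  have m0: "has_bochner_integral P (\<lambda>m. 1) (1::real)"
    unfolding P_def has_bochner_integral_iff by simp
  have m1: "has_bochner_integral P (\<lambda>m. real m) \<mu>"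
    using step[OF m0] by simp
  \<comment> \<open>E m^(k+1) equals \<mu> E (m + 1)^k, and the binomial expansion leaves only
    moments already known. The centered moments are then linear combinations of the raw
    ones.\<close>
  have m2: "has_bochner_integral P (\<lambda>m. real m ^ 2) (\<mu>\<^sup>2 + \<mu>)"
    using step[of "\<lambda>m. real m", of "\<mu> + 1"] add[OF m1 m0]
    by (simp add: power2_eq_square algebra_simps)
  have m3: "has_bochner_integral P (\<lambda>m. real m ^ 3) (\<mu>^3 + 3 * \<mu>\<^sup>2 + \<mu>)"
    using step[of "\<lambda>m. real m ^ 2", of "(\<mu>\<^sup>2 + \<mu>) + 2 * \<mu> + 1"] add[OF add[OF m2 mul[OF m1, of 2]] m0]
    by (simp add: eval_nat_numeral algebra_simps)
  have m4: "has_bochner_integral P (\<lambda>m. real m ^ 4) (\<mu>^4 + 6 * \<mu>^3 + 7 * \<mu>\<^sup>2 + \<mu>)"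
    using step[of "\<lambda>m. real m ^ 3", of "(\<mu>^3 + 3 * \<mu>\<^sup>2 + \<mu>) + 3 * (\<mu>\<^sup>2 + \<mu>) + 3 * \<mu> + 1"]
      add[OF add[OF add[OF m3 mul[OF m2, of 3]] mul[OF m1, of 3]] m0]
    by (simp add: eval_nat_numeral algebra_simps)
  show "has_bochner_integral P (\<lambda>m. real m - \<mu>) 0"
    using add[OF m1 mul[OF m0, of "-\<mu>"]] by simp
  show "has_bochner_integral P (\<lambda>m. (real m - \<mu>)\<^sup>2) \<mu>"
    using add[OF add[OF m2 mul[OF m1, of "-2*\<mu>"]] mul[OF m0, of "\<mu>^2"]]
    by (simp add: eval_nat_numeral algebra_simps)
  show "has_bochner_integral P (\<lambda>m. (real m - \<mu>) ^ 4) (\<mu> + 3 * \<mu>\<^sup>2)"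
    using add[OF add[OF add[OF add[OF m4 mul[OF m3, of "-4*\<mu>"]] mul[OF m2, of "6*\<mu>^2"]] mul[OF m1, of "-4*\<mu>^3"]] mul[OF m0, of "\<mu>^4"]]
    by (simp add: eval_nat_numeral algebra_simps)
qed

text \<open>\<open>R\<close> is the density of Poisson(\<nu>) with respect to Poisson(\<mu>). Its
  first two moments come from the generating function at \<nu> / \<mu> and at (\<nu> / \<mu>)^2; the
  centered one uses R(m + 1) = (\<nu> / \<mu>) R(m). The last value is one plus a chi-square
  divergence.\<close>

lemma poisson_ratio_moments:
  assumes \<mu>: "\<mu> > 0" and \<nu>: "\<nu> > 0"
  defines "P \<equiv> measure_pmf (poisson_pmf \<mu>)" and "R \<equiv> (\<lambda>m. exp (\<mu> - \<nu>) * (\<nu> / \<mu>) ^ m)"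
  shows poisson_ratio_moment: "has_bochner_integral P R 1"
    and poisson_ratio_centered_moment: "has_bochner_integral P (\<lambda>m. R m * (real m - \<mu>)) (\<nu> - \<mu>)"
    and poisson_ratio_square_moment: "has_bochner_integral P (\<lambda>m. (R m)\<^sup>2) (exp ((\<nu> - \<mu>)\<^sup>2 / \<mu>))"
proof -
  have "exp (\<mu> - \<nu>) * exp (\<mu> * (\<nu> / \<mu> - 1)) = 1"
    using \<mu> by (simp add: exp_add[symmetric] algebra_simps)
  then show 0: "has_bochner_integral P R 1"
    using has_bochner_integral_mult_right[OF has_bochner_integral_poisson_power[OF \<mu>, of "\<nu> / \<mu>"], of "exp (\<mu> - \<nu>)"] \<mu>
    unfolding P_def R_def by simp
  have "has_bochner_integral P (\<lambda>m. R (Suc m)) (\<nu> / \<mu>)"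
    using has_bochner_integral_mult_right[OF 0, of "\<nu> / \<mu>"] by (simp add: R_def algebra_simps)
  hence "has_bochner_integral P (\<lambda>m. real m * R m) (\<mu> * (\<nu> / \<mu>))"
    unfolding P_def using \<mu> by (intro has_bochner_integral_poisson_mult) auto
  from has_bochner_integral_diff[OF this has_bochner_integral_mult_right[OF 0, of \<mu>]] \<mu>
  show "has_bochner_integral P (\<lambda>m. R m * (real m - \<mu>)) (\<nu> - \<mu>)"
    by (simp add: algebra_simps)
  have "(R m)\<^sup>2 = exp (2 * (\<mu> - \<nu>)) * ((\<nu> / \<mu>)\<^sup>2) ^ m" for m
    unfolding R_def power_mult_distrib exp_double power_mult[symmetric] by (simp add: mult.commute)
  moreover have "exp (2 * (\<mu> - \<nu>)) * exp (\<mu> * ((\<nu> / \<mu>)\<^sup>2 - 1)) = exp ((\<nu> - \<mu>)\<^sup>2 / \<mu>)"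
    using \<mu> unfolding exp_add[symmetric] exp_inj_iff by (simp add: field_simps power2_eq_square)
  ultimately show "has_bochner_integral P (\<lambda>m. (R m)\<^sup>2) (exp ((\<nu> - \<mu>)\<^sup>2 / \<mu>))"
    using has_bochner_integral_mult_right[OF has_bochner_integral_poisson_power[OF \<mu>, of "(\<nu> / \<mu>)\<^sup>2"], of "exp (2 * (\<mu> - \<nu>))"] \<mu>
    unfolding P_def by simp
qed

section \<open>Gaussian moments and Gaussian likelihood ratios\<close>

lemma has_bochner_integral_std_normal:
  assumes "has_bochner_integral lborel (\<lambda>x. std_normal_density x * f x) I"
    and "f \<in> borel_measurable borel"
  shows "has_bochner_integral std_normal_distribution f (I :: real)"
  using assms by (intro has_bochner_integral_density) auto

lemma std_normal_moments:
  shows std_normal_moment_1: "has_bochner_integral std_normal_distribution (\<lambda>x. x) 0"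
    and std_normal_moment_2: "has_bochner_integral std_normal_distribution (\<lambda>x. x\<^sup>2) 1"
    and std_normal_moment_3: "has_bochner_integral std_normal_distribution (\<lambda>x. x ^ 3) 0"
    and std_normal_moment_4: "has_bochner_integral std_normal_distribution (\<lambda>x. x ^ 4) 3"
    and std_normal_moment_6: "has_bochner_integral std_normal_distribution (\<lambda>x. x ^ 6) 15"
proof -
  show "has_bochner_integral std_normal_distribution (\<lambda>x. x) 0"
    by (rule has_bochner_integral_std_normal) (use normal_moment_odd[of 1 0 0] in auto)
  show "has_bochner_integral std_normal_distribution (\<lambda>x. x\<^sup>2) 1"
    by (rule has_bochner_integral_std_normal) (use normal_moment_even[of 1 0 1] in auto)
  show "has_bochner_integral std_normal_distribution (\<lambda>x. x ^ 3) 0"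
    by (rule has_bochner_integral_std_normal) (use normal_moment_odd[of 1 0 1] in \<open>auto simp: numeral_3_eq_3\<close>)
  show "has_bochner_integral std_normal_distribution (\<lambda>x. x ^ 4) 3"
    by (rule has_bochner_integral_std_normal) (use normal_moment_even[of 1 0 2] in \<open>auto simp: eval_nat_numeral\<close>)
  show "has_bochner_integral std_normal_distribution (\<lambda>x. x ^ 6) 15"
    by (rule has_bochner_integral_std_normal) (use normal_moment_even[of 1 0 3] in \<open>auto simp: eval_nat_numeral\<close>)
qed

text \<open>Weighting by \<open>R\<close> turns the standard normal law into N(\<mu>, s^2), so the
  first three values are moments of the latter. For the square, the integrand is proportional to exp
  (- (x - \<mu>)^2 / s^2 + x^2 / 2), which is integrable exactly when s^2 < 2.\<close>

lemma normal_ratio_moments: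
  fixes \<mu> s :: real
  assumes s: "s > 0"
  defines "R \<equiv> (\<lambda>x. normal_density \<mu> s x / std_normal_density x)"
  shows normal_ratio_moment: "has_bochner_integral std_normal_distribution R 1"
    and normal_ratio_moment_1: "has_bochner_integral std_normal_distribution (\<lambda>x. R x * x) \<mu>"
    and normal_ratio_moment_2: "has_bochner_integral std_normal_distribution (\<lambda>x. R x * x\<^sup>2) (s\<^sup>2 + \<mu>\<^sup>2)"
    and normal_ratio_square_moment: "s\<^sup>2 < 2 \<Longrightarrow>
      has_bochner_integral std_normal_distribution (\<lambda>x. (R x)\<^sup>2) (exp (\<mu>\<^sup>2 / (2 - s\<^sup>2)) / (s * sqrt (2 - s\<^sup>2)))"
proof -
  have pos: "std_normal_density x \<noteq> 0" for x
    using normal_density_pos[of 1 0 x] by simp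
  have [measurable]: "R \<in> borel_measurable borel" unfolding R_def by measurable
  have RI: "has_bochner_integral std_normal_distribution (\<lambda>x. R x * f x) I"
    if "has_bochner_integral lborel (\<lambda>x. normal_density \<mu> s x * f x) I" "f \<in> borel_measurable borel" for f and I :: real
    by (rule has_bochner_integral_std_normal) (use that pos in \<open>auto simp: R_def\<close>)
  have n0: "has_bochner_integral lborel (\<lambda>x. normal_density \<mu> s x) 1"
    using normal_moment_even[OF s, of \<mu> 0] by simp
  have c1: "has_bochner_integral lborel (\<lambda>x. normal_density \<mu> s x * (x - \<mu>)) 0"
    using normal_moment_odd[OF s, of \<mu> 0] by simp
  have c2: "has_bochner_integral lborel (\<lambda>x. normal_density \<mu> s x * (x - \<mu>)\<^sup>2) (s\<^sup>2)"
    using normal_moment_even[OF s, of \<mu> 1] by simp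
  have n1: "has_bochner_integral lborel (\<lambda>x. normal_density \<mu> s x * x) \<mu>"
    using has_bochner_integral_add[OF c1 has_bochner_integral_mult_right[OF n0, of \<mu>]] by (simp add: algebra_simps)
  have n2: "has_bochner_integral lborel (\<lambda>x. normal_density \<mu> s x * x\<^sup>2) (s\<^sup>2 + \<mu>\<^sup>2)"
    using has_bochner_integral_add[OF has_bochner_integral_add[OF c2 has_bochner_integral_mult_right[OF c1, of "2 * \<mu>"]] has_bochner_integral_mult_right[OF n0, of "\<mu>\<^sup>2"]] by (simp add: algebra_simps power2_eq_square)
  show "has_bochner_integral std_normal_distribution R 1"
    using RI[of "\<lambda>_. 1"] n0 by simp
  show "has_bochner_integral std_normal_distribution (\<lambda>x. R x * x) \<mu>"
    using RI n1 by simp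
  show "has_bochner_integral std_normal_distribution (\<lambda>x. R x * x\<^sup>2) (s\<^sup>2 + \<mu>\<^sup>2)"
    using RI n2 by simp
  assume s2: "s\<^sup>2 < 2"
  define q where "q = sqrt (2 - s\<^sup>2)"
  have q: "q > 0" "q\<^sup>2 = 2 - s\<^sup>2" unfolding q_def using s2 by auto
  define C where "C = exp (\<mu>\<^sup>2 / q\<^sup>2) / (s * q)"
  \<comment> \<open>Completing the square exhibits a Gaussian density with mean 2 \<mu> / q^2 and
    standard deviation s / q, so the factor \<open>C\<close> in front is the second moment.\<close>
  have eq: "std_normal_density x * (R x)\<^sup>2 = C * normal_density (2 * \<mu> / q\<^sup>2) (s / q) x" for x
  proof -
    have e: "- (x - \<mu>)\<^sup>2 / s\<^sup>2 + x\<^sup>2 / 2 = \<mu>\<^sup>2 / q\<^sup>2 - (x - 2 * \<mu> / q\<^sup>2)\<^sup>2 / (2 * (s / q)\<^sup>2)"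
    proof -
      have "(x - 2 * \<mu> / q\<^sup>2)\<^sup>2 / (2 * (s / q)\<^sup>2) = (x * q\<^sup>2 - 2 * \<mu>)\<^sup>2 / (2 * s\<^sup>2 * q\<^sup>2)"
        using q(1) s by (simp add: field_simps power2_eq_square)
      moreover have "(x * q\<^sup>2 - 2 * \<mu>)\<^sup>2 = 2 * s\<^sup>2 * \<mu>\<^sup>2 + 2 * q\<^sup>2 * (x - \<mu>)\<^sup>2 - s\<^sup>2 * q\<^sup>2 * x\<^sup>2"
        unfolding q(2) by (simp add: power2_eq_square algebra_simps)
      ultimately show ?thesis
        using q(1) s by (simp add: diff_divide_distrib add_divide_distrib)
    qed
    have "std_normal_density x * (R x)\<^sup>2 = (normal_density \<mu> s x)\<^sup>2 / std_normal_density x"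
      unfolding R_def using pos by (simp add: field_simps power2_eq_square)
    also have "\<dots> = 1 / (sqrt (2 * pi) * s\<^sup>2) * exp (- (x - \<mu>)\<^sup>2 / s\<^sup>2 + x\<^sup>2 / 2)"
    proof -
      have "(exp (- (x - \<mu>)\<^sup>2 / (2 * s\<^sup>2)))\<^sup>2 / exp (- x\<^sup>2 / 2) = exp (- (x - \<mu>)\<^sup>2 / s\<^sup>2 + x\<^sup>2 / 2)"
        by (simp add: exp_double[symmetric] exp_diff[symmetric] exp_inj_iff)
      moreover have "(normal_density \<mu> s x)\<^sup>2 / std_normal_density x =
          1 / (sqrt (2 * pi) * s\<^sup>2) * ((exp (- (x - \<mu>)\<^sup>2 / (2 * s\<^sup>2)))\<^sup>2 / exp (- x\<^sup>2 / 2))"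
      proof -
        have *: "(1 / sqrt (2 * pi * s\<^sup>2) * E)\<^sup>2 / (1 / sqrt (2 * pi) * F) = 1 / (sqrt (2 * pi) * s\<^sup>2) * (E\<^sup>2 / F)" for E F
        proof -
          define r where "r = sqrt (2 * pi)"
          have r: "r > 0" unfolding r_def by simp
          have "sqrt (2 * pi * s\<^sup>2) = r * s" unfolding r_def using s by (simp add: real_sqrt_mult)
          thus ?thesis using r s unfolding r_def[symmetric] by (simp add: field_simps power2_eq_square)
        qed
        show ?thesis
          unfolding normal_density_def using *[of "exp (- (x - \<mu>)\<^sup>2 / (2 * s\<^sup>2))" "exp (- x\<^sup>2 / 2)"] by simp
      qed
      ultimately show ?thesis by simp
    qed
    also have "\<dots> = C * normal_density (2 * \<mu> / q\<^sup>2) (s / q) x"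
    proof -
      have "sqrt (2 * pi * (s / q)\<^sup>2) = sqrt (2 * pi) * (s / q)"
        using s q(1) by (simp add: real_sqrt_mult)
      moreover have "exp (\<mu>\<^sup>2 / q\<^sup>2 - (x - 2 * \<mu> / q\<^sup>2)\<^sup>2 / (2 * (s / q)\<^sup>2)) =
          exp (\<mu>\<^sup>2 / q\<^sup>2) * exp (- (x - 2 * \<mu> / q\<^sup>2)\<^sup>2 / (2 * (s / q)\<^sup>2))"
        unfolding exp_add[symmetric] by simp
      moreover have "1 / (r * s\<^sup>2) * (E * F) = E / (s * q) * (1 / (r * (s / q)) * F)" for r E F
        using s q(1) by (simp add: power2_eq_square)
      ultimately show ?thesis unfolding e C_def normal_density_def by metis
    qed
    finally show ?thesis .
  qed
  have "has_bochner_integral lborel (\<lambda>x. C * normal_density (2 * \<mu> / q\<^sup>2) (s / q) x) (C * 1)"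
    using normal_moment_even[of "s / q" "2 * \<mu> / q\<^sup>2" 0] s q by (intro has_bochner_integral_mult_right) simp
  hence "has_bochner_integral std_normal_distribution (\<lambda>x. (R x)\<^sup>2) C"
    by (intro has_bochner_integral_std_normal) (auto simp: eq)
  thus "has_bochner_integral std_normal_distribution (\<lambda>x. (R x)\<^sup>2) (exp (\<mu>\<^sup>2 / (2 - s\<^sup>2)) / (s * sqrt (2 - s\<^sup>2)))"
    unfolding C_def q(2) unfolding q_def .
qed

section \<open>The complete experiment\<close>

text \<open>
  In a pair (g, m), g is the Brownian increment divided by its standard deviation and m the
  number of jumps. \<open>complete_ratio\<close> is the likelihood ratio of the law N(\<delta>, s^2) x Poisson(\<nu>) of
  (g, m) with respect to N(0, 1) x Poisson(\<mu>); \<open>complete_score\<close> takes a real number of jumps since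
  it is later evaluated at an estimate of m, which may be negative.
\<close>

definition complete_law :: "real \<Rightarrow> (real \<times> nat) measure" where
  "complete_law \<mu> = std_normal_distribution \<Otimes>\<^sub>M measure_pmf (poisson_pmf \<mu>)"

definition complete_ratio :: "real \<Rightarrow> real \<Rightarrow> real \<Rightarrow> real \<Rightarrow> real \<times> nat \<Rightarrow> real" where
  "complete_ratio \<mu> \<nu> \<delta> s = (\<lambda>(g, m). normal_density \<delta> s g / std_normal_density g * (exp (\<mu> - \<nu>) * (\<nu> / \<mu>) ^ m))"

definition complete_score :: "real \<Rightarrow> real \<Rightarrow> real \<Rightarrow> real \<Rightarrow> real \<Rightarrow> real \<Rightarrow> real" where
  "complete_score a b \<kappa> \<mu> g x = a * g + b * (g\<^sup>2 - 1) + \<kappa> * (x - \<mu>)"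

lemma sets_complete_law [measurable_cong]: "sets (complete_law \<mu>) = sets (borel \<Otimes>\<^sub>M count_space UNIV)"
  unfolding complete_law_def by (intro sets_pair_measure_cong) auto

lemma prob_space_std_normal: "prob_space std_normal_distribution"
  using real_dist_normal_dist by (rule real_distribution.axioms)

lemma prob_space_complete_law: "prob_space (complete_law \<mu>)"
proof -
  interpret N: prob_space std_normal_distribution by (rule prob_space_std_normal)
  interpret pair_prob_space std_normal_distribution "measure_pmf (poisson_pmf \<mu>)" ..
  show ?thesis unfolding complete_law_def by unfold_locales
qed

lemma has_bochner_integral_complete_law:
  assumes "has_bochner_integral std_normal_distribution f I" "has_bochner_integral (measure_pmf (poisson_pmf \<mu>)) k J"
  shows "has_bochner_integral (complete_law \<mu>) (\<lambda>z. f (fst z) * k (snd z)) (I * J :: real)"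
  unfolding complete_law_def using assms prob_space_std_normal measure_pmf.prob_space_axioms
  by (intro has_bochner_integral_pair_mult)
     (auto intro: prob_space_imp_sigma_finite)

lemma has_bochner_integral_complete_law_fst:
  assumes "has_bochner_integral std_normal_distribution f I"
  shows "has_bochner_integral (complete_law \<mu>) (\<lambda>z. f (fst z)) (I :: real)"
  using has_bochner_integral_complete_law[OF assms, of \<mu> "\<lambda>_. 1" 1]
  by (simp add: has_bochner_integral_iff)

lemma has_bochner_integral_complete_law_snd:
  assumes "has_bochner_integral (measure_pmf (poisson_pmf \<mu>)) k J"
  shows "has_bochner_integral (complete_law \<mu>) (\<lambda>z. k (snd z)) (J :: real)"
proof -
  interpret N: prob_space std_normal_distribution by (rule prob_space_std_normal)
  have "has_bochner_integral std_normal_distribution (\<lambda>_. 1) (1 :: real)"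
    using N.prob_space by (simp add: has_bochner_integral_iff)
  from has_bochner_integral_complete_law[OF this assms] show ?thesis by simp
qed

text \<open>g and g^2 - 1 are the Hermite polynomials of degree one and two, orthogonal under the
  standard normal law with squared norms 1 and 2. The third claim is the mean of the score under
  N(\<delta>, s^2); it supplies the cross term when the remainder is squared.\<close>

lemma normal_score_moments:
  fixes a b :: real
  defines "S \<equiv> (\<lambda>g::real. a * g + b * (g\<^sup>2 - 1))"
  shows "has_bochner_integral std_normal_distribution S 0"
    and "has_bochner_integral std_normal_distribution (\<lambda>g. (S g)\<^sup>2) (a\<^sup>2 + 2 * b\<^sup>2)"
    and "s > 0 \<Longrightarrow> has_bochner_integral std_normal_distribution
      (\<lambda>g. normal_density \<delta> s g / std_normal_density g * S g) (a * \<delta> + b * (s\<^sup>2 + \<delta>\<^sup>2 - 1))"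
proof -
  interpret N: prob_space std_normal_distribution by (rule prob_space_std_normal)
  note add = has_bochner_integral_add and mul = has_bochner_integral_mult_right
  note m = std_normal_moments
  have m0: "has_bochner_integral std_normal_distribution (\<lambda>_. 1) (1 :: real)"
    using N.prob_space by (simp add: has_bochner_integral_iff)
  show "has_bochner_integral std_normal_distribution S 0"
    unfolding S_def using add[OF mul[OF m(1), of a] mul[OF add[OF m(2) mul[OF m0, of "-1"]], of b]] by simp
  have "has_bochner_integral std_normal_distribution
      (\<lambda>g. b\<^sup>2 * g ^ 4 + (2 * a * b * g ^ 3 + ((a\<^sup>2 - 2 * b\<^sup>2) * g\<^sup>2 + ((- 2 * a * b) * g + b\<^sup>2 * 1))))
      (b\<^sup>2 * 3 + (2 * a * b * 0 + ((a\<^sup>2 - 2 * b\<^sup>2) * 1 + ((- 2 * a * b) * 0 + b\<^sup>2 * 1))))"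
    by (intro add mul m m0)
  thus "has_bochner_integral std_normal_distribution (\<lambda>g. (S g)\<^sup>2) (a\<^sup>2 + 2 * b\<^sup>2)"
    unfolding S_def by (simp add: eval_nat_numeral algebra_simps)
  assume s: "s > 0"
  have "has_bochner_integral std_normal_distribution
      (\<lambda>g. a * (normal_density \<delta> s g / std_normal_density g * g) +
        b * (normal_density \<delta> s g / std_normal_density g * g\<^sup>2 - normal_density \<delta> s g / std_normal_density g))
      (a * \<delta> + b * (s\<^sup>2 + \<delta>\<^sup>2 - 1))"
    by (intro add mul has_bochner_integral_diff normal_ratio_moments s)
  thus "has_bochner_integral std_normal_distribution
      (\<lambda>g. normal_density \<delta> s g / std_normal_density g * S g) (a * \<delta> + b * (s\<^sup>2 + \<delta>\<^sup>2 - 1))"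
    by (simp add: S_def algebra_simps)
qed

text \<open>The Gaussian and the Poisson part are independent and centered, so their variances
  add.\<close>

lemma complete_score_second_moment:
  assumes "\<mu> > 0"
  shows "has_bochner_integral (complete_law \<mu>) (\<lambda>(g, m). (complete_score a b \<kappa> \<mu> g (real m))\<^sup>2)
    (a\<^sup>2 + 2 * b\<^sup>2 + \<kappa>\<^sup>2 * \<mu>)"
proof -
  note add = has_bochner_integral_add and mul = has_bochner_integral_mult_right
  have "has_bochner_integral (complete_law \<mu>)
    (\<lambda>z. (a * fst z + b * ((fst z)\<^sup>2 - 1))\<^sup>2 +
       (2 * \<kappa> * ((a * fst z + b * ((fst z)\<^sup>2 - 1)) * (real (snd z) - \<mu>)) + \<kappa>\<^sup>2 * (real (snd z) - \<mu>)\<^sup>2))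
    ((a\<^sup>2 + 2 * b\<^sup>2) + (2 * \<kappa> * (0 * 0) + \<kappa>\<^sup>2 * \<mu>))"
    by (intro add mul has_bochner_integral_complete_law_fst[OF normal_score_moments(2)]
        has_bochner_integral_complete_law_snd[OF poisson_centered_moment_2] assms
        has_bochner_integral_complete_law[OF normal_score_moments(1) poisson_centered_moment_1])
  thus ?thesis
    by (simp add: complete_score_def case_prod_beta' power2_eq_square algebra_simps)
qed

lemma sum_fourth_power_le: "((x::real) + y + z) ^ 4 \<le> 64 * (x ^ 4 + y ^ 4 + z ^ 4)"
proof -
  have two: "(x + y) ^ 4 \<le> 8 * (x ^ 4 + y ^ 4)" for x y :: real
  proof -
    have 1: "(x + y)\<^sup>2 \<le> 2 * (x\<^sup>2 + y\<^sup>2)" for x y :: real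
      using zero_le_power2[of "x - y"] by (simp add: power2_eq_square algebra_simps)
    have "((x + y)\<^sup>2)\<^sup>2 \<le> (2 * (x\<^sup>2 + y\<^sup>2))\<^sup>2" by (rule power_mono[OF 1]) simp
    also have "\<dots> = 4 * (x\<^sup>2 + y\<^sup>2)\<^sup>2" unfolding power_mult_distrib by simp
    also have "\<dots> \<le> 4 * (2 * ((x\<^sup>2)\<^sup>2 + (y\<^sup>2)\<^sup>2))" using 1[of "x\<^sup>2" "y\<^sup>2"] by simp
    finally show ?thesis by simp
  qed
  \<comment> \<open>Two uses of the two-term bound give 8 (8 (x' + y') + z'); since z' is
    nonnegative its factor may grow to 64.\<close>
  have "p \<le> 64 * (x' + y' + z')" if "0 \<le> z'" "p \<le> 8 * (q + z')" "q \<le> 8 * (x' + y')" for p q x' y' z' :: real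
    using that by argo
  from this[OF _ two two] show ?thesis by simp
qed

text \<open>\<open>C\<close> depends on \<open>a\<close> and \<open>b\<close> only. In the
  application \<kappa> grows like \<Delta>^(-1/2) while \<mu> shrinks like \<Delta>, so the term
  \<kappa>^4 \<mu> is of order 1 / \<Delta> and has to stay explicit: it becomes negligible only
  after division by n.\<close>

lemma complete_score_fourth_moment:
  obtains C where "\<And>\<mu> \<kappa>. \<mu> > 0 \<Longrightarrow> integrable (complete_law \<mu>) (\<lambda>(g, m). (complete_score a b \<kappa> \<mu> g (real m)) ^ 4) \<and>
    (LINT (g, m)|complete_law \<mu>. (complete_score a b \<kappa> \<mu> g (real m)) ^ 4) \<le> C + 64 * \<kappa> ^ 4 * (\<mu> + 3 * \<mu>\<^sup>2)"
proof -
  have int: "integrable std_normal_distribution (\<lambda>g. (b * (g\<^sup>2 - 1)) ^ 4)"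
  proof -
    have "(\<lambda>g. (b * (g\<^sup>2 - 1)) ^ 4) = (\<lambda>g. b ^ 4 * (g ^ 8 - 4 * g ^ 6 + 6 * g ^ 4 - 4 * g ^ 2 + g ^ 0))"
      by (intro ext) (simp add: eval_nat_numeral algebra_simps)
    thus ?thesis by (simp only:) (intro integrable_mult_right Bochner_Integration.integrable_add
          Bochner_Integration.integrable_diff integrable_std_normal_distribution_moment)
  qed
  define J where "J = (LINT g|std_normal_distribution. (b * (g\<^sup>2 - 1)) ^ 4)"
  have J: "has_bochner_integral std_normal_distribution (\<lambda>g. (b * (g\<^sup>2 - 1)) ^ 4) J"
    unfolding J_def using int by (rule has_bochner_integral_integrable)
  show ?thesis
  proof (rule that[of "64 * (a ^ 4 * 3 + J)"])
    fix \<mu> \<kappa> :: real assume \<mu>: "\<mu> > 0"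
    note add = has_bochner_integral_add and mul = has_bochner_integral_mult_right
    let ?B = "\<lambda>z. 64 * ((a ^ 4 * fst z ^ 4 + (b * ((fst z)\<^sup>2 - 1)) ^ 4) + \<kappa> ^ 4 * (real (snd z) - \<mu>) ^ 4)"
    let ?S = "\<lambda>(g, m). (complete_score a b \<kappa> \<mu> g (real m)) ^ 4"
    have B: "has_bochner_integral (complete_law \<mu>) ?B (64 * ((a ^ 4 * 3 + J) + \<kappa> ^ 4 * (\<mu> + 3 * \<mu>\<^sup>2)))"
      by (intro add mul has_bochner_integral_complete_law_fst[OF std_normal_moment_4] has_bochner_integral_complete_law_fst[OF J]
        has_bochner_integral_complete_law_snd[OF poisson_centered_moment_4] \<mu>)
    have le: "?S z \<le> ?B z" "0 \<le> ?S z" for z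
      using sum_fourth_power_le[of "a * fst z" "b * ((fst z)\<^sup>2 - 1)" "\<kappa> * (real (snd z) - \<mu>)"]
      by (auto simp: complete_score_def case_prod_beta' power_mult_distrib)
    have int: "integrable (complete_law \<mu>) ?S"
    proof (rule Bochner_Integration.integrable_bound)
      show "integrable (complete_law \<mu>) ?B" using B by (auto simp: has_bochner_integral_iff)
      show "?S \<in> borel_measurable (complete_law \<mu>)" unfolding complete_score_def by measurable
      show "AE z in complete_law \<mu>. norm (?S z) \<le> norm (?B z)"
      proof (intro AE_I2)
        fix z show "norm (?S z) \<le> norm (?B z)" using le[of z] unfolding real_norm_def by linarith
      qed
    qed
    have "integral\<^sup>L (complete_law \<mu>) ?S \<le> integral\<^sup>L (complete_law \<mu>) ?B"
      using B int le by (intro integral_mono) (auto simp: has_bochner_integral_iff)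
    also have "\<dots> = 64 * (a ^ 4 * 3 + J) + 64 * \<kappa> ^ 4 * (\<mu> + 3 * \<mu>\<^sup>2)"
      using B by (auto simp: has_bochner_integral_iff algebra_simps)
    finally show "integrable (complete_law \<mu>) ?S \<and> integral\<^sup>L (complete_law \<mu>) ?S
      \<le> 64 * (a ^ 4 * 3 + J) + 64 * \<kappa> ^ 4 * (\<mu> + 3 * \<mu>\<^sup>2)"
      using int by blast
  qed
qed

text \<open>Each term of the expanded square is a product of a function of g and a function of m, so
  the value is exact. Its three parts are the chi-square divergence, the squared norm of the scaled
  score, and minus twice the mean of the scaled score under the perturbed law, the score being
  centered under the original one.\<close>

lemma complete_ratio_remainder_moment:
  assumes \<mu>: "\<mu> > 0" and \<nu>: "\<nu> > 0" and s: "s > 0" "s\<^sup>2 < 2"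
  shows "has_bochner_integral (complete_law \<mu>)
    (\<lambda>(g, m). (complete_ratio \<mu> \<nu> \<delta> s (g, m) - 1 - \<eta> * complete_score a b \<kappa> \<mu> g (real m))\<^sup>2)
    (exp (\<delta>\<^sup>2 / (2 - s\<^sup>2)) / (s * sqrt (2 - s\<^sup>2)) * exp ((\<nu> - \<mu>)\<^sup>2 / \<mu>) - 1
      + \<eta>\<^sup>2 * (a\<^sup>2 + 2 * b\<^sup>2 + \<kappa>\<^sup>2 * \<mu>)
      - 2 * \<eta> * (a * \<delta> + b * (s\<^sup>2 + \<delta>\<^sup>2 - 1) + \<kappa> * (\<nu> - \<mu>)))"
proof -
  interpret L: prob_space "complete_law \<mu>" by (rule prob_space_complete_law)
  note add = has_bochner_integral_add and mul = has_bochner_integral_mult_right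
  define R1 where "R1 g = normal_density \<delta> s g / std_normal_density g" for g
  define R2 where "R2 m = exp (\<mu> - \<nu>) * (\<nu> / \<mu>) ^ m" for m :: nat
  define S1 where "S1 g = a * g + b * (g\<^sup>2 - 1)" for g :: real
  define S2 where "S2 m = real m - \<mu>" for m
  note nm = normal_ratio_moments[OF s(1), of \<delta>, folded R1_def]
  note ns = normal_score_moments[of a b, folded S1_def]
  note nrs = normal_score_moments(3)[OF s(1), of \<delta> a b, folded R1_def, folded S1_def]
  note pm = poisson_ratio_moments[OF \<mu> \<nu>, folded R2_def, folded S2_def]
  note ps = poisson_moments[OF \<mu>, folded S2_def]
  note P = has_bochner_integral_complete_law and F = has_bochner_integral_complete_law_fst and G = has_bochner_integral_complete_law_snd
  have one: "has_bochner_integral (complete_law \<mu>) (\<lambda>_. 1) (1::real)"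
    by (simp add: has_bochner_integral_iff L.prob_space)
  have sc: "has_bochner_integral (complete_law \<mu>) (\<lambda>z. (complete_score a b \<kappa> \<mu> (fst z) (real (snd z)))\<^sup>2) (a\<^sup>2 + 2 * b\<^sup>2 + \<kappa>\<^sup>2 * \<mu>)"
    using complete_score_second_moment[OF \<mu>, of a b \<kappa>] by (simp add: case_prod_beta')
  \<comment> \<open>The expanded square, with the product of ratio and score split into its Gaussian
    and its Poisson part so that every summand factorises.\<close>
  let ?X = "\<lambda>z. (R1 (fst z))\<^sup>2 * (R2 (snd z))\<^sup>2 + (1 + (\<eta>\<^sup>2 * (complete_score a b \<kappa> \<mu> (fst z) (real (snd z)))\<^sup>2
     + ((- 2) * (R1 (fst z) * R2 (snd z))
     + ((- 2 * \<eta>) * ((R1 (fst z) * S1 (fst z)) * R2 (snd z)) + ((- 2 * \<eta> * \<kappa>) * (R1 (fst z) * (R2 (snd z) * S2 (snd z)))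
     + (2 * \<eta> * S1 (fst z) + 2 * \<eta> * \<kappa> * S2 (snd z)))))))"
  have "has_bochner_integral (complete_law \<mu>) ?X
    (exp (\<delta>\<^sup>2 / (2 - s\<^sup>2)) / (s * sqrt (2 - s\<^sup>2)) * exp ((\<nu> - \<mu>)\<^sup>2 / \<mu>) + (1 + (\<eta>\<^sup>2 * (a\<^sup>2 + 2 * b\<^sup>2 + \<kappa>\<^sup>2 * \<mu>)
     + ((- 2) * (1 * 1)
     + ((- 2 * \<eta>) * ((a * \<delta> + b * (s\<^sup>2 + \<delta>\<^sup>2 - 1)) * 1) + ((- 2 * \<eta> * \<kappa>) * (1 * (\<nu> - \<mu>))
     + (2 * \<eta> * 0 + 2 * \<eta> * \<kappa> * 0)))))))"
    by (intro add mul one sc P[OF nm(4)[OF s(2)] pm(3)] P[OF nm(1) pm(1)] P[OF nrs pm(1)] P[OF nm(1) pm(2)] F[OF ns(1)] G[OF ps(1)])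
  also have "?X = (\<lambda>(g, m). (complete_ratio \<mu> \<nu> \<delta> s (g, m) - 1 - \<eta> * complete_score a b \<kappa> \<mu> g (real m))\<^sup>2)"
  proof (intro ext)
    fix z :: "real \<times> nat"
    have 1: "complete_ratio \<mu> \<nu> \<delta> s z = R1 (fst z) * R2 (snd z)"
      by (simp add: complete_ratio_def case_prod_beta' R1_def R2_def)
    have 2: "complete_score a b \<kappa> \<mu> (fst z) (real (snd z)) = S1 (fst z) + \<kappa> * S2 (snd z)"
      by (simp add: complete_score_def S1_def S2_def)
    show "?X z = (case z of (g, m) \<Rightarrow> (complete_ratio \<mu> \<nu> \<delta> s (g, m) - 1 - \<eta> * complete_score a b \<kappa> \<mu> g (real m))\<^sup>2)"
      unfolding case_prod_beta' prod.collapse 1 2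
      by (simp add: power2_eq_square algebra_simps)
  qed
  finally show ?thesis by (simp add: algebra_simps)
qed

section \<open>The score as a function of the observation\<close>

definition rounded_score :: "real \<Rightarrow> real \<Rightarrow> real \<Rightarrow> real \<Rightarrow> real \<Rightarrow> real \<Rightarrow> real" where
  "rounded_score a b \<kappa> \<mu> \<tau> y = complete_score a b \<kappa> \<mu> ((y - of_int (round y)) / \<tau>) (of_int (round y))"

text \<open>
  The score and its rounded version differ only if \<tau> \<bar>g\<bar> \<ge> 1/2; bounding 1 by 2 \<tau> \<bar>g\<bar> on this
  event produces the factor \<tau>^2.
\<close>

lemma rounded_score_error:
  fixes g \<tau> :: real and m :: nat
  assumes \<tau>: "\<tau> > 0"
  shows "(complete_score a b \<kappa> \<mu> g (real m) - rounded_score a b \<kappa> \<mu> \<tau> (\<tau> * g + real m))\<^sup>2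
    \<le> 32 * \<tau>\<^sup>2 * ((\<bar>a\<bar> + \<bar>\<kappa> * \<tau>\<bar>)\<^sup>2 * g ^ 4 + 16 * b\<^sup>2 * g ^ 6)"
proof -
  \<comment> \<open>The error made in counting the jumps. The estimate of g is then g - j / \<tau>,
    and the difference of the two scores acquires the factor j / \<tau>.\<close>
  define i where "i = round (\<tau> * g + real m) - int m"
  define j where "j = (of_int i :: real)"
  define d where "d = complete_score a b \<kappa> \<mu> g (real m) - rounded_score a b \<kappa> \<mu> \<tau> (\<tau> * g + real m)"
  define A where "A = \<bar>a\<bar> + \<bar>\<kappa> * \<tau>\<bar>"
  have rj: "of_int (round (\<tau> * g + real m)) = real m + j" by (simp add: i_def j_def)
  have jb: "\<bar>j - \<tau> * g\<bar> \<le> 1 / 2"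
    using of_int_round_abs_le[of "\<tau> * g + real m"] unfolding rj by (simp add: algebra_simps)
  have d: "d = j / \<tau> * (a + 2 * b * g - b * (j / \<tau>) - \<kappa> * \<tau>)"
    unfolding d_def rounded_score_def rj complete_score_def
    using \<tau> by (simp add: field_simps power2_eq_square)
  have "d\<^sup>2 \<le> 32 * \<tau>\<^sup>2 * (A\<^sup>2 * g ^ 4 + 16 * b\<^sup>2 * g ^ 6)"
  proof (cases "i = 0")
    case True
    hence "d = 0" unfolding d j_def by simp
    moreover have "0 \<le> 32 * \<tau>\<^sup>2 * (A\<^sup>2 * g ^ 4 + 16 * b\<^sup>2 * g ^ 6)" by simp
    ultimately show ?thesis by simp
  next
    case False
    \<comment> \<open>A nonzero integer within 1/2 of \<tau> g forces \<tau> |g| \<ge> 1/2, and then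
      |j| \<le> \<tau> |g| + 1/2 \<le> 2 \<tau> |g|.\<close>
    hence "\<bar>j\<bar> \<ge> 1" unfolding j_def by linarith
    hence tg: "1 \<le> 2 * (\<tau> * \<bar>g\<bar>)" "\<bar>j\<bar> \<le> 2 * (\<tau> * \<bar>g\<bar>)"
      using jb \<tau> abs_mult[of \<tau> g] by linarith+
    define k where "k = j / \<tau>"
    have k: "\<bar>k\<bar> \<le> 2 * \<bar>g\<bar>" unfolding k_def using tg(2) \<tau> by (simp add: field_simps)
    have "\<bar>a + 2 * b * g - b * k - \<kappa> * \<tau>\<bar> \<le> A + 2 * \<bar>b\<bar> * \<bar>g\<bar> + \<bar>b\<bar> * \<bar>k\<bar>"
      unfolding A_def using abs_mult[of "2 * b" g] abs_mult[of 2 b] abs_mult[of b k] by linarith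
    also have "\<dots> \<le> A + 4 * \<bar>b\<bar> * \<bar>g\<bar>"
      using mult_left_mono[OF k, of "\<bar>b\<bar>"] by simp
    finally have "\<bar>d\<bar> \<le> (2 * \<bar>g\<bar>) * (A + 4 * \<bar>b\<bar> * \<bar>g\<bar>)"
      unfolding d k_def[symmetric] abs_mult using k by (intro mult_mono) auto
    also have "\<dots> \<le> (2 * \<bar>g\<bar>) * (A + 4 * \<bar>b\<bar> * \<bar>g\<bar>) * (2 * (\<tau> * \<bar>g\<bar>))"
      using mult_left_mono[OF tg(1), of "(2 * \<bar>g\<bar>) * (A + 4 * \<bar>b\<bar> * \<bar>g\<bar>)"] by (simp add: A_def)
    also have "\<dots> = 4 * \<tau> * g\<^sup>2 * (A + 4 * \<bar>b\<bar> * \<bar>g\<bar>)" by (simp add: power2_eq_square)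
    finally have "\<bar>d\<bar>\<^sup>2 \<le> (4 * \<tau> * g\<^sup>2 * (A + 4 * \<bar>b\<bar> * \<bar>g\<bar>))\<^sup>2" by (intro power_mono) auto
    also have "\<dots> = 16 * \<tau>\<^sup>2 * g ^ 4 * (A + 4 * \<bar>b\<bar> * \<bar>g\<bar>)\<^sup>2"
      unfolding power_mult_distrib by simp
    also have "\<dots> \<le> 16 * \<tau>\<^sup>2 * g ^ 4 * (2 * (A\<^sup>2 + 16 * b\<^sup>2 * g\<^sup>2))"
    proof (rule mult_left_mono)
      have "0 \<le> (A - 4 * \<bar>b\<bar> * \<bar>g\<bar>)\<^sup>2" by simp
      moreover have "(A - 4 * \<bar>b\<bar> * \<bar>g\<bar>)\<^sup>2 + (A + 4 * \<bar>b\<bar> * \<bar>g\<bar>)\<^sup>2 = 2 * (A\<^sup>2 + 16 * \<bar>b\<bar>\<^sup>2 * \<bar>g\<bar>\<^sup>2)"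
        by (simp add: power2_eq_square algebra_simps)
      ultimately show "(A + 4 * \<bar>b\<bar> * \<bar>g\<bar>)\<^sup>2 \<le> 2 * (A\<^sup>2 + 16 * b\<^sup>2 * g\<^sup>2)" unfolding power2_abs by linarith
    qed simp
    finally show ?thesis by (simp add: eval_nat_numeral algebra_simps)
  qed
  thus ?thesis unfolding d_def A_def .
qed

lemma rounded_score_measurable [measurable]: "rounded_score a b \<kappa> \<mu> \<tau> \<in> borel_measurable borel"
  unfolding rounded_score_def complete_score_def round_def by measurable

text \<open>The constants 3 and 15 are the fourth and sixth moments of g. The extended nonnegative
  integral is used because the square integrability of the observed ratio is not known yet; it is
  read off later from the finiteness of the final bound.\<close>

lemma rounded_score_error_moment:
  assumes \<tau>: "\<tau> > 0"
  shows "(\<integral>\<^sup>+(g, m). ennreal ((complete_score a b \<kappa> \<mu> g (real m) - rounded_score a b \<kappa> \<mu> \<tau> (\<tau> * g + real m))\<^sup>2) \<partial>complete_law \<mu>)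
    \<le> ennreal (32 * \<tau>\<^sup>2 * ((\<bar>a\<bar> + \<bar>\<kappa> * \<tau>\<bar>)\<^sup>2 * 3 + 16 * b\<^sup>2 * 15))"
proof -
  let ?B = "\<lambda>z::real \<times> nat. 32 * \<tau>\<^sup>2 * ((\<bar>a\<bar> + \<bar>\<kappa> * \<tau>\<bar>)\<^sup>2 * fst z ^ 4 + 16 * b\<^sup>2 * fst z ^ 6)"
  have B: "has_bochner_integral (complete_law \<mu>) ?B (32 * \<tau>\<^sup>2 * ((\<bar>a\<bar> + \<bar>\<kappa> * \<tau>\<bar>)\<^sup>2 * 3 + 16 * b\<^sup>2 * 15))"
    by (intro has_bochner_integral_add has_bochner_integral_mult_right
        has_bochner_integral_complete_law_fst std_normal_moment_4 std_normal_moment_6)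
  have "(\<integral>\<^sup>+(g, m). ennreal ((complete_score a b \<kappa> \<mu> g (real m) - rounded_score a b \<kappa> \<mu> \<tau> (\<tau> * g + real m))\<^sup>2) \<partial>complete_law \<mu>)
    \<le> (\<integral>\<^sup>+z. ennreal (?B z) \<partial>complete_law \<mu>)"
    by (intro nn_integral_mono) (auto intro!: ennreal_leI rounded_score_error[OF \<tau>])
  also have "\<dots> = ennreal (32 * \<tau>\<^sup>2 * ((\<bar>a\<bar> + \<bar>\<kappa> * \<tau>\<bar>)\<^sup>2 * 3 + 16 * b\<^sup>2 * 15))"
    using B by (subst nn_integral_eq_integral) (auto simp: has_bochner_integral_iff)
  finally show ?thesis .
qed

section \<open>Reduction to the observed increment\<close>

text \<open>
  \<open>mixture_density\<close> is not normalised: the density of the observation \<tau> g + m is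
  \<open>mixture_density\<close> divided by \<tau>.
\<close>

definition mixture_weight :: "real \<Rightarrow> real \<Rightarrow> real \<Rightarrow> real \<Rightarrow> real \<Rightarrow> nat \<Rightarrow> real" where
  "mixture_weight \<tau> \<mu> \<delta> s y m = exp (- \<mu>) * \<mu> ^ m / fact m * normal_density \<delta> s ((y - real m) / \<tau>)"

definition mixture_density :: "real \<Rightarrow> real \<Rightarrow> real \<Rightarrow> real \<Rightarrow> real \<Rightarrow> real" where
  "mixture_density \<tau> \<mu> \<delta> s y = (\<Sum>m. mixture_weight \<tau> \<mu> \<delta> s y m)"

lemma mixture_weight_pos: "\<mu> > 0 \<Longrightarrow> s > 0 \<Longrightarrow> mixture_weight \<tau> \<mu> \<delta> s y m > 0"
  unfolding mixture_weight_def by (intro mult_pos_pos divide_pos_pos normal_density_pos) auto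

lemma summable_mixture_weight:
  assumes "\<mu> > 0" "s > 0"
  shows "summable (mixture_weight \<tau> \<mu> \<delta> s y)"
proof (rule summable_comparison_test')
  show "summable (\<lambda>m. (exp (- \<mu>) / sqrt (2 * pi * s\<^sup>2)) * (\<mu> ^ m /\<^sub>R fact m))"
    by (intro summable_mult summable_exp_generic)
  fix m :: nat
  have "normal_density \<delta> s ((y - real m) / \<tau>) \<le> 1 / sqrt (2 * pi * s\<^sup>2) * 1"
    unfolding normal_density_def by (intro mult_left_mono) auto
  hence "mixture_weight \<tau> \<mu> \<delta> s y m \<le> exp (- \<mu>) * \<mu> ^ m / fact m * (1 / sqrt (2 * pi * s\<^sup>2) * 1)"
    unfolding mixture_weight_def using assms by (intro mult_left_mono) auto
  thus "norm (mixture_weight \<tau> \<mu> \<delta> s y m) \<le> (exp (- \<mu>) / sqrt (2 * pi * s\<^sup>2)) * (\<mu> ^ m /\<^sub>R fact m)"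
    using mixture_weight_pos[OF assms, of \<tau> \<delta> y m] by (simp add: field_simps)
qed

lemma mixture_density_pos: "\<mu> > 0 \<Longrightarrow> s > 0 \<Longrightarrow> mixture_density \<tau> \<mu> \<delta> s y > 0"
  unfolding mixture_density_def by (intro suminf_pos summable_mixture_weight mixture_weight_pos)

lemma mixture_density_measurable [measurable]: "mixture_density \<tau> \<mu> \<delta> s \<in> borel_measurable borel"
  unfolding mixture_density_def mixture_weight_def by measurable

text \<open>For fixed m the observation y determines g = (y - m) / \<tau>, so the weights under the
  two parameters differ by the complete likelihood ratio. Summed over m, this makes the ratio of the
  mixture densities a weighted average of \<open>complete_ratio\<close>.\<close>

lemma mixture_weight_complete_ratio:
  assumes "\<mu> > 0"
  shows "mixture_weight \<tau> \<mu> 0 1 y m * complete_ratio \<mu> \<nu> \<delta> s ((y - real m) / \<tau>, m) = mixture_weight \<tau> \<nu> \<delta> s y m"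
proof -
  have "std_normal_density ((y - real m) / \<tau>) \<noteq> 0"
    using normal_density_pos[of 1 0 "(y - real m) / \<tau>"] by simp
  thus ?thesis
    unfolding mixture_weight_def complete_ratio_def using assms
    by (simp add: field_simps power_divide exp_diff exp_minus)
qed

text \<open>The substitution y = \<tau> g + m, made separately for each m with Jacobian 1 / \<tau>.
  The inner sum over m is an unnormalised conditional expectation given the observation y.\<close>

lemma nn_integral_complete_law:
  fixes F :: "real \<times> nat \<Rightarrow> ennreal"
  assumes \<mu>: "\<mu> > 0" and \<tau>: "\<tau> > 0" and [measurable]: "F \<in> borel_measurable (borel \<Otimes>\<^sub>M count_space UNIV)"
  shows "(\<integral>\<^sup>+z. F z \<partial>complete_law \<mu>) =
    (\<integral>\<^sup>+y. (\<Sum>m. ennreal (mixture_weight \<tau> \<mu> 0 1 y m / \<tau>) * F ((y - real m) / \<tau>, m)) \<partial>lborel)"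
proof -
  interpret N: prob_space std_normal_distribution by (rule prob_space_std_normal)
  interpret pair_prob_space std_normal_distribution "measure_pmf (poisson_pmf \<mu>)" ..
  have 1: "(\<integral>\<^sup>+g. F (g, m) \<partial>std_normal_distribution) =
    (\<integral>\<^sup>+y. ennreal (std_normal_density ((y - real m) / \<tau>) / \<tau>) * F ((y - real m) / \<tau>, m) \<partial>lborel)" for m
  proof -
    have "(\<integral>\<^sup>+g. F (g, m) \<partial>std_normal_distribution) = (\<integral>\<^sup>+g. ennreal (std_normal_density g) * F (g, m) \<partial>lborel)"
      by (rule nn_integral_density) auto
    also have "\<dots> = ennreal \<bar>1 / \<tau>\<bar> * (\<integral>\<^sup>+y. ennreal (std_normal_density (- real m / \<tau> + 1 / \<tau> * y)) * F (- real m / \<tau> + 1 / \<tau> * y, m) \<partial>lborel)"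
      using \<tau> by (intro nn_integral_real_affine) auto
    also have "\<dots> = (\<integral>\<^sup>+y. ennreal (1 / \<tau>) * (ennreal (std_normal_density (- real m / \<tau> + 1 / \<tau> * y)) * F (- real m / \<tau> + 1 / \<tau> * y, m)) \<partial>lborel)"
      using \<tau> by (subst nn_integral_cmult) auto
    also have "\<dots> = (\<integral>\<^sup>+y. ennreal (std_normal_density ((y - real m) / \<tau>) / \<tau>) * F ((y - real m) / \<tau>, m) \<partial>lborel)"
    proof (intro nn_integral_cong)
      fix y
      have "- real m / \<tau> + 1 / \<tau> * y = (y - real m) / \<tau>" using \<tau> by (simp add: field_simps)
      moreover have "ennreal (1 / \<tau>) * (ennreal e * f) = ennreal (e / \<tau>) * f" if "e \<ge> 0" for e f
        using \<tau> that by (simp add: mult.assoc[symmetric] ennreal_mult[symmetric])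
      ultimately show "ennreal (1 / \<tau>) * (ennreal (std_normal_density (- real m / \<tau> + 1 / \<tau> * y)) * F (- real m / \<tau> + 1 / \<tau> * y, m)) =
        ennreal (std_normal_density ((y - real m) / \<tau>) / \<tau>) * F ((y - real m) / \<tau>, m)" by simp
    qed
    finally show ?thesis .
  qed
  have "(\<integral>\<^sup>+z. F z \<partial>complete_law \<mu>) = (\<integral>\<^sup>+m. \<integral>\<^sup>+g. F (g, m) \<partial>std_normal_distribution \<partial>measure_pmf (poisson_pmf \<mu>))"
    unfolding complete_law_def by (subst nn_integral_snd[symmetric]) auto
  also have "\<dots> = (\<Sum>m. ennreal (pmf (poisson_pmf \<mu>) m) *
      (\<integral>\<^sup>+y. ennreal (std_normal_density ((y - real m) / \<tau>) / \<tau>) * F ((y - real m) / \<tau>, m) \<partial>lborel))"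
    unfolding nn_integral_measure_pmf nn_integral_count_space_nat 1 ..
  also have "\<dots> = (\<Sum>m. \<integral>\<^sup>+y. ennreal (mixture_weight \<tau> \<mu> 0 1 y m / \<tau>) * F ((y - real m) / \<tau>, m) \<partial>lborel)"
  proof (rule suminf_cong)
    fix m
    have "ennreal (pmf (poisson_pmf \<mu>) m) * (ennreal (std_normal_density ((y - real m) / \<tau>) / \<tau>) * F ((y - real m) / \<tau>, m))
      = ennreal (mixture_weight \<tau> \<mu> 0 1 y m / \<tau>) * F ((y - real m) / \<tau>, m)" for y
      unfolding mult.assoc[symmetric] using \<mu> \<tau>
      by (subst ennreal_mult[symmetric]) (auto simp: mixture_weight_def mult.commute)
    thus "ennreal (pmf (poisson_pmf \<mu>) m) *
      (\<integral>\<^sup>+y. ennreal (std_normal_density ((y - real m) / \<tau>) / \<tau>) * F ((y - real m) / \<tau>, m) \<partial>lborel) =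
      (\<integral>\<^sup>+y. ennreal (mixture_weight \<tau> \<mu> 0 1 y m / \<tau>) * F ((y - real m) / \<tau>, m) \<partial>lborel)"
      by (subst nn_integral_cmult[symmetric]) auto
  qed
  also have "\<dots> = (\<integral>\<^sup>+y. (\<Sum>m. ennreal (mixture_weight \<tau> \<mu> 0 1 y m / \<tau>) * F ((y - real m) / \<tau>, m)) \<partial>lborel)"
    by (rule nn_integral_suminf[symmetric]) (auto simp: mixture_weight_def)
  finally show ?thesis .
qed

lemma nn_integral_complete_law_observation:
  fixes f :: "real \<Rightarrow> ennreal"
  assumes \<mu>: "\<mu> > 0" and \<tau>: "\<tau> > 0" and [measurable]: "f \<in> borel_measurable borel"
  shows "(\<integral>\<^sup>+(g, m). f (\<tau> * g + real m) \<partial>complete_law \<mu>) = (\<integral>\<^sup>+y. ennreal (mixture_density \<tau> \<mu> 0 1 y / \<tau>) * f y \<partial>lborel)"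
proof -
  have "(\<integral>\<^sup>+(g, m). f (\<tau> * g + real m) \<partial>complete_law \<mu>) =
      (\<integral>\<^sup>+y. (\<Sum>m. ennreal (mixture_weight \<tau> \<mu> 0 1 y m / \<tau>) * f y) \<partial>lborel)"
    using \<tau> by (subst nn_integral_complete_law[OF \<mu> \<tau>]) auto
  also have "\<dots> = (\<integral>\<^sup>+y. ennreal (mixture_density \<tau> \<mu> 0 1 y / \<tau>) * f y \<partial>lborel)"
  proof (intro nn_integral_cong)
    fix y
    have s: "summable (mixture_weight \<tau> \<mu> 0 1 y)" using summable_mixture_weight[OF \<mu>, of 1] by simp
    have "(\<Sum>m. ennreal (mixture_weight \<tau> \<mu> 0 1 y m / \<tau>)) = ennreal (\<Sum>m. mixture_weight \<tau> \<mu> 0 1 y m / \<tau>)"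
      using \<mu> \<tau> by (intro suminf_ennreal2 summable_divide s less_imp_le[OF divide_pos_pos] mixture_weight_pos) auto
    also have "(\<Sum>m. mixture_weight \<tau> \<mu> 0 1 y m / \<tau>) = mixture_density \<tau> \<mu> 0 1 y / \<tau>"
      unfolding mixture_density_def by (rule suminf_divide[OF s])
    finally show "(\<Sum>m. ennreal (mixture_weight \<tau> \<mu> 0 1 y m / \<tau>) * f y) = ennreal (mixture_density \<tau> \<mu> 0 1 y / \<tau>) * f y"
      by simp
  qed
  finally show ?thesis .
qed

text \<open>Jensen's inequality for the square: with D the weighted mean, sum the inequality 2 D d -
  D^2 \<le> d^2 against the weights. The right-hand side may be infinite, hence the extended values
  and the case distinction.\<close>

lemma weighted_mean_square_le:
  fixes w d :: "nat \<Rightarrow> real"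
  assumes w: "\<And>m. w m \<ge> 0" "summable w" "suminf w > 0" and wd: "summable (\<lambda>m. w m * d m)"
  shows "ennreal (suminf w * ((\<Sum>m. w m * d m) / suminf w)\<^sup>2) \<le> (\<Sum>m. ennreal (w m * (d m)\<^sup>2))"
proof (cases "summable (\<lambda>m. w m * (d m)\<^sup>2)")
  case True
  define D where "D = (\<Sum>m. w m * d m) / suminf w"
  have "suminf w * D\<^sup>2 = 2 * D * (\<Sum>m. w m * d m) - D\<^sup>2 * suminf w"
    unfolding D_def using w(3) by (simp add: field_simps power2_eq_square)
  also have "\<dots> = (\<Sum>m. 2 * D * (w m * d m) - D\<^sup>2 * w m)"
    using w(2) wd by (simp add: suminf_diff[symmetric] suminf_mult summable_mult)
  also have "\<dots> \<le> (\<Sum>m. w m * (d m)\<^sup>2)"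
  proof (rule suminf_le)
    show "2 * D * (w m * d m) - D\<^sup>2 * w m \<le> w m * (d m)\<^sup>2" for m
      using mult_nonneg_nonneg[OF w(1)[of m] zero_le_power2[of "d m - D"]]
      by (simp add: power2_eq_square algebra_simps)
    show "summable (\<lambda>m. 2 * D * (w m * d m) - D\<^sup>2 * w m)"
      using w(2) wd by (intro summable_diff summable_mult)
  qed fact
  finally have "ennreal (suminf w * D\<^sup>2) \<le> ennreal (\<Sum>m. w m * (d m)\<^sup>2)" by (rule ennreal_leI)
  also have "\<dots> = (\<Sum>m. ennreal (w m * (d m)\<^sup>2))"
    using True w(1) by (intro suminf_ennreal2[symmetric]) auto
  finally show ?thesis unfolding D_def .
next
  case False
  have "0 \<le> w m * (d m)\<^sup>2" for m using w(1) by simp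
  from summable_suminf_not_top[of "\<lambda>m. w m * (d m)\<^sup>2", OF this] False
  have "(\<Sum>m. ennreal (w m * (d m)\<^sup>2)) = top" by argo
  thus ?thesis by simp
qed

text \<open>
  The ratio of the mixture densities at \<tau> g + m is the conditional expectation of
  \<open>complete_ratio\<close> given \<tau> g + m.
\<close>

lemma mixture_ratio_projection:
  fixes \<mu> \<nu> \<delta> s \<tau> :: real and h :: "real \<Rightarrow> real"
  assumes \<mu>: "\<mu> > 0" and \<nu>: "\<nu> > 0" and s: "s > 0" and \<tau>: "\<tau> > 0" and [measurable]: "h \<in> borel_measurable borel"
  defines "r \<equiv> (\<lambda>y. mixture_density \<tau> \<nu> \<delta> s y / mixture_density \<tau> \<mu> 0 1 y)"
  shows "(\<integral>\<^sup>+(g, m). ennreal ((r (\<tau> * g + real m) - 1 - h (\<tau> * g + real m))\<^sup>2) \<partial>complete_law \<mu>)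
    \<le> (\<integral>\<^sup>+(g, m). ennreal ((complete_ratio \<mu> \<nu> \<delta> s (g, m) - 1 - h (\<tau> * g + real m))\<^sup>2) \<partial>complete_law \<mu>)"
proof -
  have [measurable]: "r \<in> borel_measurable borel" unfolding r_def by measurable
  have [measurable]: "complete_ratio \<mu> \<nu> \<delta> s \<in> borel_measurable (borel \<Otimes>\<^sub>M count_space UNIV)"
    unfolding complete_ratio_def by measurable
  have "(\<integral>\<^sup>+(g, m). ennreal ((r (\<tau> * g + real m) - 1 - h (\<tau> * g + real m))\<^sup>2) \<partial>complete_law \<mu>) =
      (\<integral>\<^sup>+y. ennreal (mixture_density \<tau> \<mu> 0 1 y / \<tau>) * ennreal ((r y - 1 - h y)\<^sup>2) \<partial>lborel)"
    by (rule nn_integral_complete_law_observation[OF \<mu> \<tau>]) measurable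
  also have "\<dots> \<le> (\<integral>\<^sup>+y. (\<Sum>m. ennreal (mixture_weight \<tau> \<mu> 0 1 y m / \<tau>) *
      ennreal ((complete_ratio \<mu> \<nu> \<delta> s ((y - real m) / \<tau>, m) - 1 - h (\<tau> * ((y - real m) / \<tau>) + real m))\<^sup>2)) \<partial>lborel)"
  proof (rule nn_integral_mono)
    \<comment> \<open>For fixed y the weights \<open>w\<close> are the unnormalised conditional law
      of m. Since h depends on y alone, the weighted mean of \<open>d\<close> is r y - 1 - h y, and
      the claim at y is Jensen's inequality.\<close>
    fix y
    define w where "w m = mixture_weight \<tau> \<mu> 0 1 y m / \<tau>" for m
    define d where "d m = complete_ratio \<mu> \<nu> \<delta> s ((y - real m) / \<tau>, m) - 1 - h y" for m
    have s0: "summable (mixture_weight \<tau> \<mu> 0 1 y)" using summable_mixture_weight[OF \<mu>, of 1] by simp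
    have s1: "summable (mixture_weight \<tau> \<nu> \<delta> s y)" by (rule summable_mixture_weight[OF \<nu> s])
    have w: "w m > 0" for m unfolding w_def using mixture_weight_pos[OF \<mu>, of 1] \<tau> by simp
    have sw: "suminf w = mixture_density \<tau> \<mu> 0 1 y / \<tau>"
      unfolding w_def mixture_density_def by (rule suminf_divide[OF s0])
    have wd: "w m * d m = mixture_weight \<tau> \<nu> \<delta> s y m / \<tau> - (1 + h y) * w m" for m
      using mixture_weight_complete_ratio[OF \<mu>, of \<tau> y m \<nu> \<delta> s]
      by (simp add: w_def d_def algebra_simps)
    have sumw: "summable w" unfolding w_def by (intro summable_divide s0)
    have swd: "(\<Sum>m. w m * d m) = mixture_density \<tau> \<nu> \<delta> s y / \<tau> - (1 + h y) * suminf w"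
      unfolding wd mixture_density_def using s1 sumw
      by (simp add: suminf_diff[symmetric] suminf_mult suminf_divide summable_divide summable_mult)
    have pos: "suminf w > 0" using sumw w by (rule suminf_pos)
    have "(\<Sum>m. w m * d m) / suminf w = r y - 1 - h y"
      unfolding swd using pos \<tau> unfolding r_def by (simp add: sw field_simps)
    moreover have "summable (\<lambda>m. w m * d m)"
      unfolding wd by (intro summable_diff summable_mult summable_divide s1 sumw)
    from weighted_mean_square_le[of w d, OF less_imp_le[OF w] sumw pos this]
    have "ennreal (suminf w * ((\<Sum>m. w m * d m) / suminf w)\<^sup>2) \<le> (\<Sum>m. ennreal (w m * (d m)\<^sup>2))" .
    ultimately have "ennreal (suminf w * (r y - 1 - h y)\<^sup>2) \<le> (\<Sum>m. ennreal (w m * (d m)\<^sup>2))"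
      by metis
    moreover have "ennreal (w m * (d m)\<^sup>2) = ennreal (w m) * ennreal ((d m)\<^sup>2)" for m
      using w[of m] by (intro ennreal_mult) auto
    moreover have "ennreal (suminf w * (r y - 1 - h y)\<^sup>2) = ennreal (suminf w) * ennreal ((r y - 1 - h y)\<^sup>2)"
      using pos by (intro ennreal_mult) auto
    moreover have "\<tau> * ((y - real m) / \<tau>) + real m = y" for m using \<tau> by simp
    ultimately show "ennreal (mixture_density \<tau> \<mu> 0 1 y / \<tau>) * ennreal ((r y - 1 - h y)\<^sup>2) \<le> (\<Sum>m. ennreal (mixture_weight \<tau> \<mu> 0 1 y m / \<tau>) *
      ennreal ((complete_ratio \<mu> \<nu> \<delta> s ((y - real m) / \<tau>, m) - 1 - h (\<tau> * ((y - real m) / \<tau>) + real m))\<^sup>2))"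
      by (simp add: sw w_def d_def)
  qed
  also have "\<dots> = (\<integral>\<^sup>+(g, m). ennreal ((complete_ratio \<mu> \<nu> \<delta> s (g, m) - 1 - h (\<tau> * g + real m))\<^sup>2) \<partial>complete_law \<mu>)"
    by (subst nn_integral_complete_law[OF \<mu> \<tau>]) auto
  finally show ?thesis .
qed

text \<open>Integrating the ratio against its own denominator leaves the perturbed mixture density.
  Its total mass is found by returning to the pair (g, m), where \<open>complete_ratio\<close> is a
  product of two densities of mean one.\<close>

lemma mixture_ratio_mean:
  assumes \<mu>: "\<mu> > 0" and \<nu>: "\<nu> > 0" and s: "s > 0" and \<tau>: "\<tau> > 0"
  shows "has_bochner_integral (complete_law \<mu>)
    (\<lambda>(g, m). mixture_density \<tau> \<nu> \<delta> s (\<tau> * g + real m) / mixture_density \<tau> \<mu> 0 1 (\<tau> * g + real m)) 1"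
proof -
  have [measurable]: "complete_ratio \<mu> \<nu> \<delta> s \<in> borel_measurable (borel \<Otimes>\<^sub>M count_space UNIV)"
    unfolding complete_ratio_def by measurable
  let ?r = "\<lambda>y. mixture_density \<tau> \<nu> \<delta> s y / mixture_density \<tau> \<mu> 0 1 y"
  have pos: "mixture_density \<tau> \<mu> 0 1 y > 0" "mixture_density \<tau> \<nu> \<delta> s y > 0" for y
    using mixture_density_pos[OF \<mu>, of 1] mixture_density_pos[OF \<nu> s] by auto
  have crpos: "complete_ratio \<mu> \<nu> \<delta> s z \<ge> 0" for z
    unfolding complete_ratio_def case_prod_beta' using \<mu> \<nu>
    by (intro mult_nonneg_nonneg divide_nonneg_nonneg normal_density_nonneg) auto
  have cr: "has_bochner_integral (complete_law \<mu>) (complete_ratio \<mu> \<nu> \<delta> s) (1 * 1)"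
    using has_bochner_integral_complete_law[OF normal_ratio_moment[OF s] poisson_ratio_moment[OF \<mu> \<nu>], of \<delta>]
    unfolding complete_ratio_def case_prod_beta' .
  have "(\<integral>\<^sup>+(g, m). ennreal (?r (\<tau> * g + real m)) \<partial>complete_law \<mu>) =
      (\<integral>\<^sup>+y. ennreal (mixture_density \<tau> \<mu> 0 1 y / \<tau>) * ennreal (?r y) \<partial>lborel)"
    by (rule nn_integral_complete_law_observation[OF \<mu> \<tau>]) measurable
  also have "\<dots> = (\<integral>\<^sup>+y. (\<Sum>m. ennreal (mixture_weight \<tau> \<mu> 0 1 y m / \<tau>) * ennreal (complete_ratio \<mu> \<nu> \<delta> s ((y - real m) / \<tau>, m))) \<partial>lborel)"
  proof (rule nn_integral_cong)
    fix y
    have s1: "summable (mixture_weight \<tau> \<nu> \<delta> s y)" by (rule summable_mixture_weight[OF \<nu> s])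
    have "ennreal (mixture_weight \<tau> \<mu> 0 1 y m / \<tau>) * ennreal (complete_ratio \<mu> \<nu> \<delta> s ((y - real m) / \<tau>, m)) =
        ennreal (mixture_weight \<tau> \<nu> \<delta> s y m / \<tau>)" for m
      using mixture_weight_complete_ratio[OF \<mu>, of \<tau> y m \<nu> \<delta> s] mixture_weight_pos[OF \<mu>, of 1 \<tau> 0 y m] \<tau> crpos
      by (simp add: ennreal_mult[symmetric])
    moreover have "(\<Sum>m. ennreal (mixture_weight \<tau> \<nu> \<delta> s y m / \<tau>)) = ennreal (mixture_density \<tau> \<nu> \<delta> s y / \<tau>)"
    proof -
      have "mixture_density \<tau> \<nu> \<delta> s y / \<tau> = (\<Sum>m. mixture_weight \<tau> \<nu> \<delta> s y m / \<tau>)"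
        unfolding mixture_density_def by (rule suminf_divide[OF s1, symmetric])
      thus ?thesis
        by (simp only:) (intro suminf_ennreal2 summable_divide s1 less_imp_le[OF divide_pos_pos] mixture_weight_pos \<nu> s \<tau>)
    qed
    moreover have "ennreal (mixture_density \<tau> \<mu> 0 1 y / \<tau>) * ennreal (?r y) = ennreal (mixture_density \<tau> \<nu> \<delta> s y / \<tau>)"
      using pos[of y] \<tau> by (subst ennreal_mult[symmetric]) auto
    ultimately show "ennreal (mixture_density \<tau> \<mu> 0 1 y / \<tau>) * ennreal (?r y) =
      (\<Sum>m. ennreal (mixture_weight \<tau> \<mu> 0 1 y m / \<tau>) * ennreal (complete_ratio \<mu> \<nu> \<delta> s ((y - real m) / \<tau>, m)))"
      by simp
  qed
  also have "\<dots> = (\<integral>\<^sup>+z. ennreal (complete_ratio \<mu> \<nu> \<delta> s z) \<partial>complete_law \<mu>)"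
    by (rule nn_integral_complete_law[OF \<mu> \<tau>, symmetric]) measurable
  also have "\<dots> = ennreal 1"
    using cr crpos by (subst nn_integral_eq_integral) (auto simp: has_bochner_integral_iff)
  finally have "(\<integral>\<^sup>+(g, m). ennreal (?r (\<tau> * g + real m)) \<partial>complete_law \<mu>) = ennreal 1" .
  hence "(\<integral>\<^sup>+z. ennreal (case z of (g, m) \<Rightarrow> ?r (\<tau> * g + real m)) \<partial>complete_law \<mu>) = ennreal 1"
    by (simp only: case_prod_beta')
  thus ?thesis
  proof (intro has_bochner_integral_nn_integral AE_I2)
    show "0 \<le> (case z of (g, m) \<Rightarrow> ?r (\<tau> * g + real m))" for z
      using pos[of "\<tau> * fst z + real (snd z)"] by (simp add: case_prod_beta')
  qed auto
qed

section \<open>Asymptotics of one increment\<close>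

text \<open>The expression is n times the chi-square divergence of the complete experiment. Both
  exponents are of order 1/n and merge into V n / n; the remaining factor C n is treated through n
  (e^(V/n) C - 1) = n (e^(V/n) - 1) C + n (C - 1).\<close>

lemma chi2_rate: "(\<lambda>n. real n * (exp (W / n) * exp ((a / sqrt n)\<^sup>2 / (2 - (1 + b / sqrt n)\<^sup>2)) /
    ((1 + b / sqrt n) * sqrt (2 - (1 + b / sqrt n)\<^sup>2)) - 1)) \<longlonglongrightarrow> W + a\<^sup>2 + 2 * b\<^sup>2"
proof -
  define C where "C n = 1 / ((1 + b / sqrt (real n)) * sqrt (2 - (1 + b / sqrt (real n))\<^sup>2))" for n :: nat
  define V where "V n = W + a\<^sup>2 / (2 - (1 + b / sqrt (real n))\<^sup>2)" for n :: nat
  have C: "C \<longlonglongrightarrow> 1" unfolding C_def by real_asymp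
  \<comment> \<open>With s = 1 + b / sqrt n one has s^2 (2 - s^2) = 1 - (s^2 - 1)^2, and s^2 - 1 is
    about 2 b / sqrt n; hence C - 1 is about 2 b^2 / n.\<close>
  have "(\<lambda>n. real n * (1 / ((1 + b / sqrt (real n)) * sqrt (2 - (1 + b / sqrt (real n))\<^sup>2)) - 1)) \<longlonglongrightarrow> 2 * b\<^sup>2"
    if "b \<noteq> 0" for b :: real
    using that unfolding neq_iff by (elim disjE; real_asymp; simp add: power2_eq_square)
  hence nC: "(\<lambda>n. real n * (C n - 1)) \<longlonglongrightarrow> 2 * b\<^sup>2"
    unfolding C_def by (cases "b = 0") auto
  have V: "V \<longlonglongrightarrow> W + a\<^sup>2"
    unfolding V_def by real_asymp
  have V0: "(\<lambda>n. V n / real n) \<longlonglongrightarrow> 0"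
    by (rule real_tendsto_divide_at_top[OF V filterlim_real_sequentially])
  \<comment> \<open>The removable singularity is filled in because V n may be 0, for instance when W
    and a vanish.\<close>
  have "((\<lambda>x. if x = 0 then 1 else (exp x - 1) / x :: real) \<longlongrightarrow> 1) (at 0)"
    by (rule Lim_transform_eventually[where f="\<lambda>x. (exp x - 1) / x"])
       (real_asymp, auto simp: eventually_at_filter)
  hence "isCont (\<lambda>x. if x = 0 then 1 else (exp x - 1) / x :: real) 0"
    by (simp add: isCont_def)
  from isCont_tendsto_compose[OF this V0]
  have "(\<lambda>n. if V n / real n = 0 then 1 else (exp (V n / real n) - 1) / (V n / real n)) \<longlonglongrightarrow> 1"
    by (simp only: refl if_True)
  hence "(\<lambda>n. V n * (if V n / real n = 0 then 1 else (exp (V n / real n) - 1) / (V n / real n))) \<longlonglongrightarrow> W + a\<^sup>2"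
    using tendsto_mult[OF V] by force
  hence nE: "(\<lambda>n. real n * (exp (V n / real n) - 1)) \<longlonglongrightarrow> W + a\<^sup>2"
    by (rule Lim_transform_eventually)
       (use eventually_gt_at_top[of 0] in eventually_elim, auto)
  have "(\<lambda>n. real n * (exp (V n / real n) - 1) * C n + real n * (C n - 1)) \<longlonglongrightarrow> (W + a\<^sup>2) * 1 + 2 * b\<^sup>2"
    by (intro tendsto_intros nE nC C)
  also have "(\<lambda>n. real n * (exp (V n / real n) - 1) * C n + real n * (C n - 1)) =
    (\<lambda>n. real n * (exp (V n / real n) * C n - 1))"
    by (simp add: algebra_simps)
  finally show ?thesis
    by (simp add: C_def V_def exp_add[symmetric] power_divide add_divide_distrib mult.commute)
qed

lemma nn_integral_square_add_le:
  fixes f g :: "'a \<Rightarrow> real"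
  assumes [measurable]: "f \<in> borel_measurable M" "g \<in> borel_measurable M"
  shows "(\<integral>\<^sup>+x. ennreal ((f x + g x)\<^sup>2) \<partial>M) \<le> 2 * (\<integral>\<^sup>+x. ennreal ((f x)\<^sup>2) \<partial>M) + 2 * (\<integral>\<^sup>+x. ennreal ((g x)\<^sup>2) \<partial>M)"
proof -
  have "(\<integral>\<^sup>+x. ennreal ((f x + g x)\<^sup>2) \<partial>M) \<le> (\<integral>\<^sup>+x. 2 * ennreal ((f x)\<^sup>2) + 2 * ennreal ((g x)\<^sup>2) \<partial>M)"
  proof (rule nn_integral_mono)
    fix x
    have "(f x + g x)\<^sup>2 \<le> 2 * (f x)\<^sup>2 + 2 * (g x)\<^sup>2"
      using zero_le_power2[of "f x - g x"] by (simp add: power2_eq_square algebra_simps)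
    hence "ennreal ((f x + g x)\<^sup>2) \<le> ennreal (2 * (f x)\<^sup>2 + 2 * (g x)\<^sup>2)" by (rule ennreal_leI)
    thus "ennreal ((f x + g x)\<^sup>2) \<le> 2 * ennreal ((f x)\<^sup>2) + 2 * ennreal ((g x)\<^sup>2)"
      by (simp add: ennreal_plus ennreal_mult')
  qed
  also have "\<dots> = 2 * (\<integral>\<^sup>+x. ennreal ((f x)\<^sup>2) \<partial>M) + 2 * (\<integral>\<^sup>+x. ennreal ((g x)\<^sup>2) \<partial>M)"
    by (simp add: nn_integral_add nn_integral_cmult)
  finally show ?thesis .
qed

text \<open>The contraction compares r - 1 only with functions of the observation, so
  \<open>H\<close> has to be inserted both before and after projecting. Each insertion costs a
  factor 2, and 2 (2 V + 2 \<eta>^2 W) + 2 \<eta>^2 W is the origin of 4 and 6.\<close>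

lemma mixture_ratio_score_error:
  fixes \<mu> \<nu> \<delta> s \<tau> \<eta> a b \<kappa> :: real
  assumes \<mu>: "\<mu> > 0" and \<nu>: "\<nu> > 0" and s: "s > 0" "s\<^sup>2 < 2" and \<tau>: "\<tau> > 0"
  defines "r \<equiv> (\<lambda>(g, m). mixture_density \<tau> \<nu> \<delta> s (\<tau> * g + real m) / mixture_density \<tau> \<mu> 0 1 (\<tau> * g + real m))"
    and "S \<equiv> (\<lambda>(g, m). \<eta> * complete_score a b \<kappa> \<mu> g (real m))"
    and "V \<equiv> exp (\<delta>\<^sup>2 / (2 - s\<^sup>2)) / (s * sqrt (2 - s\<^sup>2)) * exp ((\<nu> - \<mu>)\<^sup>2 / \<mu>) - 1
      + \<eta>\<^sup>2 * (a\<^sup>2 + 2 * b\<^sup>2 + \<kappa>\<^sup>2 * \<mu>)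
      - 2 * \<eta> * (a * \<delta> + b * (s\<^sup>2 + \<delta>\<^sup>2 - 1) + \<kappa> * (\<nu> - \<mu>))"
    and "W \<equiv> 32 * \<tau>\<^sup>2 * ((\<bar>a\<bar> + \<bar>\<kappa> * \<tau>\<bar>)\<^sup>2 * 3 + 16 * b\<^sup>2 * 15)"
  shows "integrable (complete_law \<mu>) (\<lambda>z. (r z - 1 - S z)\<^sup>2)"
    and "(LINT z|complete_law \<mu>. (r z - 1 - S z)\<^sup>2) \<le> 4 * V + 6 * (\<eta>\<^sup>2 * W)"
proof -
  let ?P = "complete_law \<mu>"
  define h where "h y = \<eta> * rounded_score a b \<kappa> \<mu> \<tau> y" for y
  define H where "H = (\<lambda>(g, m). h (\<tau> * g + real m))"
  have [measurable]: "h \<in> borel_measurable borel" unfolding h_def by measurable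
  have [measurable]: "complete_ratio \<mu> \<nu> \<delta> s \<in> borel_measurable ?P" "S \<in> borel_measurable ?P"
      "H \<in> borel_measurable ?P" "r \<in> borel_measurable ?P"
    unfolding complete_ratio_def S_def complete_score_def H_def r_def by measurable
  have CR: "has_bochner_integral ?P (\<lambda>z. (complete_ratio \<mu> \<nu> \<delta> s z - 1 - S z)\<^sup>2) V"
    using complete_ratio_remainder_moment[OF \<mu> \<nu> s, of \<delta> \<eta> a b \<kappa>]
    unfolding V_def S_def by (simp add: case_prod_beta')
  hence nCR: "(\<integral>\<^sup>+z. ennreal ((complete_ratio \<mu> \<nu> \<delta> s z - 1 - S z)\<^sup>2) \<partial>?P) = ennreal V"
    by (subst nn_integral_eq_integral) (auto simp: has_bochner_integral_iff)
  have V: "V \<ge> 0"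
    using CR by (auto simp: has_bochner_integral_iff intro: integral_nonneg)
  have W: "W \<ge> 0" unfolding W_def by simp
  have nSH: "(\<integral>\<^sup>+z. ennreal ((S z - H z)\<^sup>2) \<partial>?P) \<le> ennreal (\<eta>\<^sup>2 * W)"
  proof -
    have "(\<integral>\<^sup>+z. ennreal ((S z - H z)\<^sup>2) \<partial>?P) = (\<integral>\<^sup>+z. ennreal (\<eta>\<^sup>2) * (case z of (g, m) \<Rightarrow>
        ennreal ((complete_score a b \<kappa> \<mu> g (real m) - rounded_score a b \<kappa> \<mu> \<tau> (\<tau> * g + real m))\<^sup>2)) \<partial>?P)"
      by (intro nn_integral_cong)
         (auto simp: S_def H_def h_def ennreal_mult[symmetric] power_mult_distrib[symmetric] right_diff_distrib)
    also have "\<dots> = ennreal (\<eta>\<^sup>2) * (\<integral>\<^sup>+(g, m).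
        ennreal ((complete_score a b \<kappa> \<mu> g (real m) - rounded_score a b \<kappa> \<mu> \<tau> (\<tau> * g + real m))\<^sup>2) \<partial>?P)"
      by (rule nn_integral_cmult) (unfold complete_score_def, measurable)
    also have "\<dots> \<le> ennreal (\<eta>\<^sup>2) * ennreal W"
      unfolding W_def by (intro mult_left_mono rounded_score_error_moment[OF \<tau>]) auto
    finally show ?thesis using W by (simp add: ennreal_mult)
  qed
  have "(\<integral>\<^sup>+z. ennreal ((r z - 1 - H z)\<^sup>2) \<partial>?P) \<le> (\<integral>\<^sup>+z. ennreal ((complete_ratio \<mu> \<nu> \<delta> s z - 1 - H z)\<^sup>2) \<partial>?P)"
    using mixture_ratio_projection[OF \<mu> \<nu> s(1) \<tau>, of h \<delta>] unfolding r_def H_def by (simp add: case_prod_beta')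
  also have "\<dots> = (\<integral>\<^sup>+z. ennreal (((complete_ratio \<mu> \<nu> \<delta> s z - 1 - S z) + (S z - H z))\<^sup>2) \<partial>?P)" by (simp add: algebra_simps)
  also have "\<dots> \<le> 2 * ennreal V + 2 * ennreal (\<eta>\<^sup>2 * W)"
    by (rule order_trans[OF nn_integral_square_add_le]) (use nCR nSH in \<open>auto intro!: add_mono mult_left_mono\<close>)
  finally have rH: "(\<integral>\<^sup>+z. ennreal ((r z - 1 - H z)\<^sup>2) \<partial>?P) \<le> 2 * ennreal V + 2 * ennreal (\<eta>\<^sup>2 * W)" .
  have SH': "(\<integral>\<^sup>+z. ennreal ((H z - S z)\<^sup>2) \<partial>?P) \<le> ennreal (\<eta>\<^sup>2 * W)"
    using nSH by (simp add: power2_commute)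
  have "(\<integral>\<^sup>+z. ennreal ((r z - 1 - S z)\<^sup>2) \<partial>?P) = (\<integral>\<^sup>+z. ennreal (((r z - 1 - H z) + (H z - S z))\<^sup>2) \<partial>?P)" by (simp add: algebra_simps)
  also have "\<dots> \<le> 2 * (2 * ennreal V + 2 * ennreal (\<eta>\<^sup>2 * W)) + 2 * ennreal (\<eta>\<^sup>2 * W)"
    by (rule order_trans[OF nn_integral_square_add_le]) (measurable, intro add_mono mult_left_mono rH SH', simp_all)
  also have "\<dots> = 4 * ennreal V + 6 * ennreal (\<eta>\<^sup>2 * W)"
    by (simp add: distrib_left mult.assoc[symmetric] add.assoc distrib_right[symmetric])
  also have "\<dots> = ennreal (4 * V + 6 * (\<eta>\<^sup>2 * W))"
  proof -
    have "4 * ennreal p + 6 * ennreal k = ennreal (4 * p + 6 * k)" if "p \<ge> 0" "k \<ge> 0" for p k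
      using that by (simp add: ennreal_plus ennreal_mult')
    from this[OF V, of "\<eta>\<^sup>2 * W"] show ?thesis using W by simp
  qed
  finally have le: "(\<integral>\<^sup>+z. ennreal ((r z - 1 - S z)\<^sup>2) \<partial>?P) \<le> ennreal (4 * V + 6 * (\<eta>\<^sup>2 * W))" .
  show int: "integrable ?P (\<lambda>z. (r z - 1 - S z)\<^sup>2)"
    by (rule integrableI_bounded) (use le in \<open>auto simp: less_top[symmetric] top_unique\<close>)
  have "ennreal (LINT z|?P. (r z - 1 - S z)\<^sup>2) = (\<integral>\<^sup>+z. ennreal ((r z - 1 - S z)\<^sup>2) \<partial>?P)"
    using int by (intro nn_integral_eq_integral[symmetric]) auto
  with le have "ennreal (LINT z|?P. (r z - 1 - S z)\<^sup>2) \<le> ennreal (4 * V + 6 * (\<eta>\<^sup>2 * W))" by (simp only:)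
  thus "(LINT z|?P. (r z - 1 - S z)\<^sup>2) \<le> 4 * V + 6 * (\<eta>\<^sup>2 * W)"
    by (subst (asm) ennreal_le_iff) (use V W in auto)
qed

lemma row_char_asymptotics:
  fixes \<Delta> :: "nat \<Rightarrow> real" and \<sigma> lam a b w t :: real
  assumes \<Delta>: "\<And>n. 0 < \<Delta> n" "\<Delta> \<longlonglongrightarrow> 0" and n\<Delta>: "filterlim (\<lambda>n. real n * \<Delta> n) at_top sequentially"
    and \<sigma>: "\<sigma> > 0" and lam: "lam > 0"
  defines "r \<equiv> (\<lambda>n y. mixture_density (\<sigma> * sqrt (\<Delta> n)) ((lam + w / sqrt (real n * \<Delta> n)) * \<Delta> n) (a / sqrt (real n)) (1 + b / sqrt (real n)) y
      / mixture_density (\<sigma> * sqrt (\<Delta> n)) (lam * \<Delta> n) 0 1 y)"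
  shows "(\<lambda>n. of_nat n * ((CLINT z|complete_law (lam * \<Delta> n).
      iexp (t * ln (r n (\<sigma> * sqrt (\<Delta> n) * fst z + real (snd z))))) - 1))
    \<longlonglongrightarrow> - (of_real (t\<^sup>2) + \<i> * of_real t) / 2 * of_real (a\<^sup>2 + 2 * b\<^sup>2 + w\<^sup>2 / lam)"
proof -
  define q where "q = a\<^sup>2 + 2 * b\<^sup>2 + w\<^sup>2 / lam"
  define c where "c = (of_real (t\<^sup>2) + \<i> * of_real t) / (2 :: complex)"
  \<comment> \<open>\<open>\<kappa>\<close> is such that \<kappa> / sqrt n is the relative change
    (\<nu> - \<mu>) / \<mu> of the Poisson mean, the first-order coefficient of m - \<mu> in the
    likelihood ratio. It may blow up as \<Delta> tends to 0, but \<kappa>^2 \<mu> and \<kappa>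
    \<tau> do not depend on n.\<close>
  define \<tau> \<mu> \<nu> \<delta> s \<kappa> where "\<tau> n = \<sigma> * sqrt (\<Delta> n)" and "\<mu> n = lam * \<Delta> n" and "\<nu> n = (lam + w / sqrt (real n * \<Delta> n)) * \<Delta> n"
    and "\<delta> n = a / sqrt (real n)" and "s n = 1 + b / sqrt (real n)" and "\<kappa> n = w / (lam * sqrt (\<Delta> n))" for n
  define R where "R n z = r n (\<tau> n * fst z + real (snd z))" for n and z :: "real \<times> nat"
  define S where "S n z = 1 / sqrt (real n) * complete_score a b (\<kappa> n) (\<mu> n) (fst z) (real (snd z))" for n and z :: "real \<times> nat"
  define \<phi> where "\<phi> n = (CLINT z|complete_law (\<mu> n). iexp (t * ln (R n z)))" for n
  have q: "q \<ge> 0" unfolding q_def using lam by simp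
  have \<mu>: "\<mu> n > 0" and \<tau>: "\<tau> n > 0" for n unfolding \<mu>_def \<tau>_def using \<Delta>(1)[of n] lam \<sigma> by auto
  have \<kappa>\<mu>: "(\<kappa> n)\<^sup>2 * \<mu> n = w\<^sup>2 / lam" for n
    unfolding \<kappa>_def \<mu>_def using \<Delta>(1)[of n] lam by (simp add: power_divide power_mult_distrib field_simps power2_eq_square)
  have \<kappa>\<tau>: "\<kappa> n * \<tau> n = w * \<sigma> / lam" for n
    unfolding \<kappa>_def \<tau>_def using \<Delta>(1)[of n] lam by simp
  have s_lim: "s \<longlonglongrightarrow> 1" unfolding s_def by real_asymp
  have rt: "filterlim (\<lambda>n. sqrt (real n * \<Delta> n)) at_top sequentially"
    by (rule filterlim_compose[OF sqrt_at_top n\<Delta>])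
  have "(\<lambda>n. lam + w / sqrt (real n * \<Delta> n)) \<longlonglongrightarrow> lam + 0"
    by (intro tendsto_add tendsto_const real_tendsto_divide_at_top[OF tendsto_const rt])
  hence ev_lam: "\<forall>\<^sub>F n in sequentially. lam + w / sqrt (real n * \<Delta> n) > 0"
    using lam by (intro order_tendstoD(1)) auto
  have "(\<lambda>n. (s n)\<^sup>2) \<longlonglongrightarrow> 1\<^sup>2" by (intro tendsto_power s_lim)
  hence ev_s2: "\<forall>\<^sub>F n in sequentially. (s n)\<^sup>2 < 2" by (intro order_tendstoD(2)) auto
  have ev_s: "\<forall>\<^sub>F n in sequentially. s n > 0" using s_lim by (intro order_tendstoD(1)) auto
  obtain C where C: "\<And>\<mu> \<kappa>. \<mu> > 0 \<Longrightarrow> integrable (complete_law \<mu>) (\<lambda>(g, m). (complete_score a b \<kappa> \<mu> g (real m)) ^ 4) \<and>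
    (LINT (g, m)|complete_law \<mu>. (complete_score a b \<kappa> \<mu> g (real m)) ^ 4) \<le> C + 64 * \<kappa> ^ 4 * (\<mu> + 3 * \<mu>\<^sup>2)"
    by (rule complete_score_fourth_moment[of a b]) blast
  define V where "V n = exp ((\<delta> n)\<^sup>2 / (2 - (s n)\<^sup>2)) / (s n * sqrt (2 - (s n)\<^sup>2)) * exp ((\<nu> n - \<mu> n)\<^sup>2 / \<mu> n) - 1
      + (1 / sqrt (real n))\<^sup>2 * (a\<^sup>2 + 2 * b\<^sup>2 + (\<kappa> n)\<^sup>2 * \<mu> n)
      - 2 * (1 / sqrt (real n)) * (a * \<delta> n + b * ((s n)\<^sup>2 + (\<delta> n)\<^sup>2 - 1) + \<kappa> n * (\<nu> n - \<mu> n))" for n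
  define W where "W n = 32 * (\<tau> n)\<^sup>2 * ((\<bar>a\<bar> + \<bar>\<kappa> n * \<tau> n\<bar>)\<^sup>2 * 3 + 16 * b\<^sup>2 * 15)" for n
  \<comment> \<open>n times the bounds on the two error terms of the second-order estimate: the
    squared L2 distance from r - 1 to the scaled score, and the fourth moment of the scaled
    score.\<close>
  define e where "e n = real n * (4 * V n + 6 * ((1 / sqrt (real n))\<^sup>2 * W n)) +
     real n * ((1 / sqrt (real n)) ^ 4 * (C + 64 * (\<kappa> n) ^ 4 * (\<mu> n + 3 * (\<mu> n)\<^sup>2)))" for n
  \<comment> \<open>Multiplied by n, the three parts of \<open>V\<close> tend to q, q and -2 q. The
    term with b (a^2 + b^2) / sqrt n is the second-order part of the mean of the score under the
    perturbed law.\<close>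
  have nV: "(\<lambda>n. real n * V n) \<longlonglongrightarrow> 0"
  proof -
    have l1: "(\<lambda>n. real n * (exp ((w\<^sup>2 / lam) / n) * exp ((a / sqrt n)\<^sup>2 / (2 - (1 + b / sqrt n)\<^sup>2)) /
      ((1 + b / sqrt n) * sqrt (2 - (1 + b / sqrt n)\<^sup>2)) - 1)) \<longlonglongrightarrow> w\<^sup>2 / lam + a\<^sup>2 + 2 * b\<^sup>2"
      by (rule chi2_rate)
    have l2: "(\<lambda>n. b * (a\<^sup>2 + b\<^sup>2) / sqrt (real n)) \<longlonglongrightarrow> 0"
      by (rule real_tendsto_divide_at_top[OF tendsto_const filterlim_compose[OF sqrt_at_top filterlim_real_sequentially]])
    have "(\<lambda>n. real n * (exp ((w\<^sup>2 / lam) / n) * exp ((a / sqrt n)\<^sup>2 / (2 - (1 + b / sqrt n)\<^sup>2)) /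
      ((1 + b / sqrt n) * sqrt (2 - (1 + b / sqrt n)\<^sup>2)) - 1) + q - 2 * (a\<^sup>2 + 2 * b\<^sup>2 + w\<^sup>2 / lam + b * (a\<^sup>2 + b\<^sup>2) / sqrt (real n)))
      \<longlonglongrightarrow> (w\<^sup>2 / lam + a\<^sup>2 + 2 * b\<^sup>2) + q - 2 * (a\<^sup>2 + 2 * b\<^sup>2 + w\<^sup>2 / lam + 0)"
      by (intro tendsto_intros l1 l2)
    moreover have "(w\<^sup>2 / lam + a\<^sup>2 + 2 * b\<^sup>2) + q - 2 * (a\<^sup>2 + 2 * b\<^sup>2 + w\<^sup>2 / lam + 0) = 0"
      unfolding q_def by simp
    ultimately have "(\<lambda>n. real n * (exp ((w\<^sup>2 / lam) / n) * exp ((a / sqrt n)\<^sup>2 / (2 - (1 + b / sqrt n)\<^sup>2)) /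
      ((1 + b / sqrt n) * sqrt (2 - (1 + b / sqrt n)\<^sup>2)) - 1) + q - 2 * (a\<^sup>2 + 2 * b\<^sup>2 + w\<^sup>2 / lam + b * (a\<^sup>2 + b\<^sup>2) / sqrt (real n)))
      \<longlonglongrightarrow> 0" by (simp only:)
    thus ?thesis
    proof (rule Lim_transform_eventually)
      show "\<forall>\<^sub>F n in sequentially. real n * (exp ((w\<^sup>2 / lam) / n) * exp ((a / sqrt n)\<^sup>2 / (2 - (1 + b / sqrt n)\<^sup>2)) /
      ((1 + b / sqrt n) * sqrt (2 - (1 + b / sqrt n)\<^sup>2)) - 1) + q - 2 * (a\<^sup>2 + 2 * b\<^sup>2 + w\<^sup>2 / lam + b * (a\<^sup>2 + b\<^sup>2) / sqrt (real n)) = real n * V n"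
        using eventually_gt_at_top[of 0]
      proof eventually_elim
        case (elim n)
        define x where "x = sqrt (real n)"
        define y where "y = sqrt (\<Delta> n)"
        have x: "x > 0" "real n = x\<^sup>2" and y: "y > 0" "\<Delta> n = y\<^sup>2" and xy: "sqrt (real n * \<Delta> n) = x * y"
          unfolding x_def y_def using elim \<Delta>(1)[of n] by (auto simp: real_sqrt_mult less_imp_le)
        have nm: "\<nu> n - \<mu> n = w * y / x"
          unfolding \<nu>_def \<mu>_def xy unfolding y(2) using x(1) y(1) lam by (simp add: field_simps power2_eq_square)
        have 1: "(\<nu> n - \<mu> n)\<^sup>2 / \<mu> n = (w\<^sup>2 / lam) / real n"
          unfolding nm unfolding \<mu>_def x(2) y(2) using x(1) y(1) lam by (simp add: field_simps power2_eq_square)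
        have 2: "\<kappa> n * (\<nu> n - \<mu> n) = w\<^sup>2 / lam / x"
          unfolding nm unfolding \<kappa>_def y_def[symmetric] using x(1) y(1) lam by (simp add: field_simps power2_eq_square)
        have 3: "a * \<delta> n + b * ((s n)\<^sup>2 + (\<delta> n)\<^sup>2 - 1) = (a\<^sup>2 + 2 * b\<^sup>2 + b * (a\<^sup>2 + b\<^sup>2) / x) / x"
          unfolding \<delta>_def s_def x_def[symmetric] using x(1) by (simp add: field_simps power2_eq_square)
        have "real n * V n = real n * (exp ((w\<^sup>2 / lam) / n) * exp ((\<delta> n)\<^sup>2 / (2 - (s n)\<^sup>2)) / (s n * sqrt (2 - (s n)\<^sup>2)) - 1)
          + real n * (1 / x)\<^sup>2 * q - 2 * (real n * (1 / x) * ((a\<^sup>2 + 2 * b\<^sup>2 + b * (a\<^sup>2 + b\<^sup>2) / x) / x + w\<^sup>2 / lam / x))"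
          unfolding V_def 1 2 3 \<kappa>\<mu> q_def[symmetric] x_def[symmetric] by (simp add: algebra_simps)
        also have "real n * (1 / x)\<^sup>2 * q = q" using x by (simp add: power_divide)
        also have "real n * (1 / x) * ((a\<^sup>2 + 2 * b\<^sup>2 + b * (a\<^sup>2 + b\<^sup>2) / x) / x + w\<^sup>2 / lam / x) =
           a\<^sup>2 + 2 * b\<^sup>2 + w\<^sup>2 / lam + b * (a\<^sup>2 + b\<^sup>2) / x"
          unfolding x(2) using x(1) by (simp add: field_simps power2_eq_square)
        finally show ?case unfolding \<delta>_def s_def x_def[symmetric] by simp
      qed
    qed
  qed
  have e: "e \<longlonglongrightarrow> 0"
  proof -
    have i: "(\<lambda>n. k / real n) \<longlonglongrightarrow> 0" for k :: real
      by (rule real_tendsto_divide_at_top[OF tendsto_const filterlim_real_sequentially])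
    \<comment> \<open>The jump part of the fourth moment, of order 1 / (n \<Delta>). The next limit
      is the rounding error, of order \<tau>^2 and hence of order \<Delta>.\<close>
    have j: "(\<lambda>n. 64 * (w / lam) ^ 4 * lam / (real n * \<Delta> n)) \<longlonglongrightarrow> 0"
      by (rule real_tendsto_divide_at_top[OF tendsto_const n\<Delta>])
    have k: "(\<lambda>n. 32 * (\<sigma>\<^sup>2 * \<Delta> n) * ((\<bar>a\<bar> + \<bar>w * \<sigma> / lam\<bar>)\<^sup>2 * 3 + 16 * b\<^sup>2 * 15)) \<longlonglongrightarrow> 32 * (\<sigma>\<^sup>2 * 0) * ((\<bar>a\<bar> + \<bar>w * \<sigma> / lam\<bar>)\<^sup>2 * 3 + 16 * b\<^sup>2 * 15)"
      by (intro tendsto_intros \<Delta>)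
    have "(\<lambda>n. 4 * (real n * V n) + 6 * (32 * (\<sigma>\<^sup>2 * \<Delta> n) * ((\<bar>a\<bar> + \<bar>w * \<sigma> / lam\<bar>)\<^sup>2 * 3 + 16 * b\<^sup>2 * 15)) +
       (C / real n + (64 * (w / lam) ^ 4 * lam / (real n * \<Delta> n) + (64 * (w / lam) ^ 4 * (3 * lam\<^sup>2)) / real n)))
       \<longlonglongrightarrow> 4 * 0 + 6 * (32 * (\<sigma>\<^sup>2 * 0) * ((\<bar>a\<bar> + \<bar>w * \<sigma> / lam\<bar>)\<^sup>2 * 3 + 16 * b\<^sup>2 * 15)) + (0 + (0 + 0))"
      by (intro tendsto_add tendsto_mult tendsto_const nV i j k)
    hence "(\<lambda>n. 4 * (real n * V n) + 6 * (32 * (\<sigma>\<^sup>2 * \<Delta> n) * ((\<bar>a\<bar> + \<bar>w * \<sigma> / lam\<bar>)\<^sup>2 * 3 + 16 * b\<^sup>2 * 15)) +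
       (C / real n + (64 * (w / lam) ^ 4 * lam / (real n * \<Delta> n) + (64 * (w / lam) ^ 4 * (3 * lam\<^sup>2)) / real n))) \<longlonglongrightarrow> 0"
      by simp
    thus ?thesis
    proof (rule Lim_transform_eventually)
      show "\<forall>\<^sub>F n in sequentially. 4 * (real n * V n) + 6 * (32 * (\<sigma>\<^sup>2 * \<Delta> n) * ((\<bar>a\<bar> + \<bar>w * \<sigma> / lam\<bar>)\<^sup>2 * 3 + 16 * b\<^sup>2 * 15)) +
       (C / real n + (64 * (w / lam) ^ 4 * lam / (real n * \<Delta> n) + (64 * (w / lam) ^ 4 * (3 * lam\<^sup>2)) / real n)) = e n"
        using eventually_gt_at_top[of 0]
      proof eventually_elim
        case (elim n)
        have 1: "real n * ((1 / sqrt (real n))\<^sup>2 * x) = x" for x using elim by (simp add: power_divide)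
        have 2: "real n * ((1 / sqrt (real n)) ^ 4 * x) = x / real n" for x
        proof -
          have "(1 / sqrt (real n)) ^ 4 = ((1 / sqrt (real n))\<^sup>2)\<^sup>2" by simp
          also have "\<dots> = 1 / (real n)\<^sup>2" using elim by (simp only: power_divide real_sqrt_pow2) simp
          finally show ?thesis using elim by (simp add: power2_eq_square)
        qed
        have 3: "(\<tau> n)\<^sup>2 = \<sigma>\<^sup>2 * \<Delta> n" unfolding \<tau>_def using \<Delta>(1)[of n] by (simp add: power_mult_distrib)
        have 4: "(\<kappa> n) ^ 4 = (w / lam) ^ 4 / (\<Delta> n)\<^sup>2"
        proof -
          have "(\<kappa> n)\<^sup>2 = (w / lam)\<^sup>2 / \<Delta> n"
            unfolding \<kappa>_def using \<Delta>(1)[of n] by (simp add: power_divide power_mult_distrib)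
          hence "((\<kappa> n)\<^sup>2)\<^sup>2 = ((w / lam)\<^sup>2 / \<Delta> n)\<^sup>2" by simp
          thus ?thesis by (simp add: power_divide power_mult_distrib)
        qed
        have 5: "(C + 64 * ((w / lam) ^ 4 / (\<Delta> n)\<^sup>2) * (lam * \<Delta> n + 3 * (lam * \<Delta> n)\<^sup>2)) / real n =
            C / real n + (64 * (w / lam) ^ 4 * lam / (real n * \<Delta> n) + (64 * (w / lam) ^ 4 * (3 * lam\<^sup>2)) / real n)"
        proof -
          have "(C + 64 * (X / d\<^sup>2) * (lam * d + 3 * (lam * d)\<^sup>2)) / m = C / m + (64 * X * lam / (m * d) + (64 * X * (3 * lam\<^sup>2)) / m)"
            if "d > 0" "m > 0" for X d m :: real
            using that by (simp add: field_simps power2_eq_square)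
          from this[OF \<Delta>(1)[of n], of "real n" "(w / lam) ^ 4"] elim show ?thesis by simp
        qed
        have "e n = 4 * (real n * V n) + 6 * (real n * ((1 / sqrt (real n))\<^sup>2 * W n)) +
          real n * ((1 / sqrt (real n)) ^ 4 * (C + 64 * (\<kappa> n) ^ 4 * (\<mu> n + 3 * (\<mu> n)\<^sup>2)))"
          unfolding e_def by (simp add: algebra_simps)
        thus ?case unfolding 1 2 W_def 3 4 \<mu>_def 5 \<kappa>\<tau> by simp
      qed
    qed
  qed
  \<comment> \<open>\<epsilon> and K are left free because K is available only after \<epsilon> has
    been chosen. The positivity of the perturbed parameters and s^2 < 2 are only guaranteed for
    large n.\<close>
  have main: "\<forall>\<^sub>F n in sequentially. cmod (of_nat n * (\<phi> n - 1) - (- c * of_real q)) \<le> \<epsilon> * q + K * e n"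
    if K: "K \<ge> 0" and bnd: "\<And>(P :: (real \<times> nat) measure) (D :: real \<times> nat \<Rightarrow> real) S. \<lbrakk>prob_space P; integrable P D; integral\<^sup>L P D = 0;
      \<And>x. D x > -1; S \<in> borel_measurable P; integrable P (\<lambda>x. (S x)\<^sup>2); integrable P (\<lambda>x. (S x)^4);
      integrable P (\<lambda>x. (D x - S x)\<^sup>2)\<rbrakk> \<Longrightarrow>
    cmod ((CLINT x|P. iexp (t * ln (1 + D x))) - 1 + c * of_real (LINT x|P. (S x)\<^sup>2))
      \<le> \<epsilon> * (LINT x|P. (S x)\<^sup>2) + K * ((LINT x|P. (D x - S x)\<^sup>2) + (LINT x|P. (S x)^4))" for \<epsilon> K
    using eventually_gt_at_top[of 0] ev_lam ev_s ev_s2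
  proof eventually_elim
    case (elim n)
    let ?P = "complete_law (\<mu> n)"
    interpret P: prob_space ?P by (rule prob_space_complete_law)
    have \<nu>: "\<nu> n > 0" unfolding \<nu>_def using elim \<Delta>(1)[of n] by simp
    have Reta: "R n = (\<lambda>(g, m). mixture_density (\<tau> n) (\<nu> n) (\<delta> n) (s n) (\<tau> n * g + real m) / mixture_density (\<tau> n) (\<mu> n) 0 1 (\<tau> n * g + real m))"
      unfolding R_def r_def \<tau>_def \<nu>_def \<mu>_def \<delta>_def s_def by (auto simp: fun_eq_iff)
    have Seta: "S n = (\<lambda>(g, m). 1 / sqrt (real n) * complete_score a b (\<kappa> n) (\<mu> n) g (real m))"
      unfolding S_def by (auto simp: fun_eq_iff)
    have Rmean: "has_bochner_integral ?P (R n) 1"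
      unfolding Reta by (rule mixture_ratio_mean[OF \<mu> \<nu> elim(3) \<tau>])
    have Rpos: "R n z > 0" for z
      unfolding Reta case_prod_beta' using mixture_density_pos[OF \<nu> elim(3)] mixture_density_pos[OF \<mu>, of 1] by simp
    have [measurable]: "S n \<in> borel_measurable ?P" unfolding S_def complete_score_def by measurable
    have S2: "has_bochner_integral ?P (\<lambda>z. (S n z)\<^sup>2) ((1 / sqrt (real n))\<^sup>2 * q)"
      using has_bochner_integral_mult_right[OF complete_score_second_moment[OF \<mu>[of n], of a b "\<kappa> n"], of "(1 / sqrt (real n))\<^sup>2"]
      unfolding S_def power_mult_distrib \<kappa>\<mu> q_def case_prod_beta' by blast
    have S4: "integrable ?P (\<lambda>z. (S n z) ^ 4)"
       "(LINT z|?P. (S n z) ^ 4) \<le> (1 / sqrt (real n)) ^ 4 * (C + 64 * (\<kappa> n) ^ 4 * (\<mu> n + 3 * (\<mu> n)\<^sup>2))"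
      using C[OF \<mu>[of n], of "\<kappa> n"] unfolding S_def power_mult_distrib case_prod_beta'
      by (auto simp del: power_one_over intro!: mult_left_mono)
    note err = mixture_ratio_score_error[OF \<mu>[of n] \<nu> elim(3,4) \<tau>[of n], of "\<delta> n" "1 / sqrt (real n)" a b "\<kappa> n",
        folded Reta Seta V_def W_def]
    have i0: "integrable ?P (R n)" "(LINT z|?P. R n z) = 1" using Rmean by (auto simp: has_bochner_integral_iff)
    have "cmod ((CLINT z|?P. iexp (t * ln (1 + (R n z - 1)))) - 1 + c * of_real (LINT z|?P. (S n z)\<^sup>2))
      \<le> \<epsilon> * (LINT z|?P. (S n z)\<^sup>2) + K * ((LINT z|?P. (R n z - 1 - S n z)\<^sup>2) + (LINT z|?P. (S n z)^4))"
    proof (rule bnd)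
      show "prob_space ?P" by (rule prob_space_complete_law)
      show "integrable ?P (\<lambda>z. R n z - 1)" using i0 by simp
      show "(LINT z|?P. R n z - 1) = 0" using i0 by (simp add: P.prob_space)
      show "-1 < R n z - 1" for z using Rpos[of z] by simp
      show "integrable ?P (\<lambda>z. (S n z)\<^sup>2)" using S2 by (simp add: has_bochner_integral_iff)
      show "S n \<in> borel_measurable ?P" by fact
      show "integrable ?P (\<lambda>z. (S n z) ^ 4)" by (rule S4(1))
      show "integrable ?P (\<lambda>z. (R n z - 1 - S n z)\<^sup>2)" by (rule err(1))
    qed
    also have "(LINT z|?P. (S n z)\<^sup>2) = (1 / sqrt (real n))\<^sup>2 * q" using S2 by (simp add: has_bochner_integral_iff)
    finally have "cmod ((\<phi> n - 1) + c * of_real (1 / real n * q)) \<le> \<epsilon> * (1 / real n * q) + K * ((LINT z|?P. (R n z - 1 - S n z)\<^sup>2) + (LINT z|?P. (S n z)^4))"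
      using elim by (simp add: \<phi>_def power_divide)
    also have "\<dots> \<le> \<epsilon> * (1 / real n * q) + K * ((4 * V n + 6 * ((1 / sqrt (real n))\<^sup>2 * W n)) + (1 / sqrt (real n)) ^ 4 * (C + 64 * (\<kappa> n) ^ 4 * (\<mu> n + 3 * (\<mu> n)\<^sup>2)))"
      using K err(2) S4(2) by (intro add_left_mono mult_left_mono add_mono)
    also have "\<dots> = (\<epsilon> * q + K * e n) / real n"
      unfolding e_def using elim by (simp add: field_simps)
    finally have "real n * cmod ((\<phi> n - 1) + c * of_real (1 / real n * q)) \<le> \<epsilon> * q + K * e n"
      using elim by (simp add: field_simps)
    moreover have "of_nat n * (\<phi> n - 1) - (- c * of_real q) = of_nat n * ((\<phi> n - 1) + c * of_real (1 / real n * q))"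
      using elim by (simp add: field_simps)
    ultimately show ?case by (simp add: norm_mult)
  qed
  have "(\<lambda>n. of_nat n * (\<phi> n - 1)) \<longlonglongrightarrow> - c * of_real q"
  proof (rule tendstoI)
    fix x :: real assume x: "x > 0"
    define \<epsilon> where "\<epsilon> = x / (2 * (q + 1))"
    have \<epsilon>: "\<epsilon> > 0" "\<epsilon> * q < x"
      unfolding \<epsilon>_def using x q by (auto simp: field_simps intro: add_nonneg_pos)
    obtain K where K: "K \<ge> 0" and bnd: "\<And>(P :: (real \<times> nat) measure) (D :: real \<times> nat \<Rightarrow> real) S. \<lbrakk>prob_space P; integrable P D; integral\<^sup>L P D = 0;
      \<And>x. D x > -1; S \<in> borel_measurable P; integrable P (\<lambda>x. (S x)\<^sup>2); integrable P (\<lambda>x. (S x)^4);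
      integrable P (\<lambda>x. (D x - S x)\<^sup>2)\<rbrakk> \<Longrightarrow>
    cmod ((CLINT x|P. iexp (t * ln (1 + D x))) - 1 + c * of_real (LINT x|P. (S x)\<^sup>2))
      \<le> \<epsilon> * (LINT x|P. (S x)\<^sup>2) + K * ((LINT x|P. (D x - S x)\<^sup>2) + (LINT x|P. (S x)^4))"
      unfolding c_def by (rule char_ln_second_order_bound[OF \<epsilon>(1), of t]) blast
    have "(\<lambda>n. \<epsilon> * q + K * e n) \<longlonglongrightarrow> \<epsilon> * q + K * 0" by (intro tendsto_intros e)
    hence "\<forall>\<^sub>F n in sequentially. \<epsilon> * q + K * e n < x" using \<epsilon>(2) by (intro order_tendstoD(2)) auto
    moreover have "\<forall>\<^sub>F n in sequentially. cmod (of_nat n * (\<phi> n - 1) - (- c * of_real q)) \<le> \<epsilon> * q + K * e n"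
      by (rule main[OF K]) (rule bnd)
    ultimately show "\<forall>\<^sub>F n in sequentially. dist (of_nat n * (\<phi> n - 1)) (- c * of_real q) < x"
      by eventually_elim (simp add: dist_norm)
  qed
  thus ?thesis unfolding \<phi>_def R_def c_def q_def \<tau>_def \<mu>_def by (simp only: minus_divide_left)
qed

section \<open>From increments to the likelihood ratio\<close>

text \<open>No complex logarithm is taken: for two numbers of the closed unit disc, the n-th powers
  differ by at most n times the difference. This is applied to \<phi> n and exp (c / n), the latter
  lying in the disc because Re c \<le> 0.\<close>

lemma power_tendsto_exp:
  fixes \<phi> :: "nat \<Rightarrow> complex" and c :: complex
  assumes \<phi>: "\<forall>\<^sub>F n in sequentially. cmod (\<phi> n) \<le> 1" and c: "Re c \<le> 0"
    and lim: "(\<lambda>n. of_nat n * (\<phi> n - 1)) \<longlonglongrightarrow> c"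
  shows "(\<lambda>n. \<phi> n ^ n) \<longlonglongrightarrow> exp c"
proof -
  have e: "(\<lambda>n. of_nat n * (exp (c / of_nat n) - 1)) \<longlonglongrightarrow> c"
  proof (cases "c = 0")
    case False
    have "((\<lambda>h. (exp h - 1) / h) \<longlongrightarrow> 1) (at (0::complex))"
      using DERIV_exp[of "0::complex"] by (simp add: DERIV_def)
    moreover have "(\<lambda>n. c / of_nat n) \<longlonglongrightarrow> 0" by (rule lim_const_over_n)
    hence "filterlim (\<lambda>n. c / of_nat n) (at 0) sequentially"
      using eventually_gt_at_top[of "0::nat"] False
      by (intro filterlim_atI) (auto elim!: eventually_mono)
    ultimately have "(\<lambda>n. (exp (c / of_nat n) - 1) / (c / of_nat n)) \<longlonglongrightarrow> 1"
      by (rule filterlim_compose)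
    hence "(\<lambda>n. c * ((exp (c / of_nat n) - 1) / (c / of_nat n))) \<longlonglongrightarrow> c * 1"
      by (intro tendsto_mult tendsto_const)
    thus ?thesis using False by (simp add: divide_divide_eq_right mult.commute)
  qed simp
  have "(\<lambda>n. cmod (of_nat n * (\<phi> n - 1) - of_nat n * (exp (c / of_nat n) - 1))) \<longlonglongrightarrow> cmod (c - c)"
    by (intro tendsto_norm tendsto_diff lim e)
  hence z: "(\<lambda>n. cmod (of_nat n * (\<phi> n - 1) - of_nat n * (exp (c / of_nat n) - 1))) \<longlonglongrightarrow> 0" by simp
  have "(\<lambda>n. \<phi> n ^ n - exp c) \<longlonglongrightarrow> 0"
  proof (rule Lim_null_comparison[OF _ z])
    show "\<forall>\<^sub>F n in sequentially. norm (\<phi> n ^ n - exp c) \<le> cmod (of_nat n * (\<phi> n - 1) - of_nat n * (exp (c / of_nat n) - 1))"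
      using eventually_gt_at_top[of 0] \<phi>
    proof eventually_elim
      case (elim n)
      have "exp c = exp (c / of_nat n) ^ n"
        using elim by (simp add: exp_of_nat_mult[symmetric])
      hence "norm (\<phi> n ^ n - exp c) = norm (\<phi> n ^ n - exp (c / of_nat n) ^ n)" by simp
      also have "\<dots> \<le> real n * norm (\<phi> n - exp (c / of_nat n))"
        using elim c by (intro norm_power_diff) (auto simp: norm_exp_eq_Re Re_divide_of_nat divide_nonpos_nonneg)
      also have "\<dots> = cmod (of_nat n * (\<phi> n - 1) - of_nat n * (exp (c / of_nat n) - 1))"
        by (simp add: right_diff_distrib[symmetric] norm_mult)
      finally show ?case .
    qed
  qed
  thus ?thesis by (simp add: LIM_zero_iff)
qed

lemma char_lan_limit_law:
  assumes "q \<ge> 0"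
  shows "char (lan_limit_law q) t = exp (- (of_real (t\<^sup>2) + \<i> * of_real t) / 2 * of_real q)"
proof -
  have "char (lan_limit_law q) t = (CLINT g|std_normal_distribution. iexp (t * (sqrt q * g - q / 2)))"
    unfolding lan_limit_law_def char_def by (subst integral_distr) auto
  also have "\<dots> = (CLINT g|std_normal_distribution. iexp (- t * q / 2) * iexp ((t * sqrt q) * g))"
    by (intro Bochner_Integration.integral_cong refl) (simp add: exp_add[symmetric] algebra_simps)
  also have "\<dots> = iexp (- t * q / 2) * char std_normal_distribution (t * sqrt q)"
    unfolding char_def by (rule integral_mult_right_zero)
  also have "\<dots> = iexp (- t * q / 2) * exp (of_real (- ((t * sqrt q)\<^sup>2) / 2))"
    unfolding char_std_normal_distribution exp_of_real ..
  also have "\<dots> = exp (- (of_real (t\<^sup>2) + \<i> * of_real t) / 2 * of_real q)"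
  proof -
    have *: "(t * sqrt q)\<^sup>2 = t\<^sup>2 * q" using assms by (simp add: power_mult_distrib)
    show ?thesis unfolding exp_add[symmetric] * by (simp add: field_simps)
  qed
  finally show ?thesis .
qed

text \<open>y is the increment with the true drift removed, measured in units of the true standard
  deviation by dividing by \<sigma> sqrt \<Delta>. Other parameters then appear as a shift and a
  scaling of the standard normal g. The Jacobian 1 / (\<sigma> sqrt \<Delta>) involves the true
  \<sigma> only, so it cancels in the likelihood ratio.\<close>

lemma trans_dens_eq_mixture_density:
  assumes \<sigma>: "\<sigma> > 0" and \<sigma>': "\<sigma>' > 0" and lam': "lam' > 0" and \<Delta>: "\<Delta> > 0"
  shows "trans_dens \<theta>' \<sigma>' lam' \<Delta> x (x + (\<theta> - lam) * \<Delta> + y) =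
    mixture_density (\<sigma> * sqrt \<Delta>) (lam' * \<Delta>) (((\<theta>' - lam') - (\<theta> - lam)) * sqrt \<Delta> / \<sigma>) (\<sigma>' / \<sigma>) y / (\<sigma> * sqrt \<Delta>)"
proof -
  define d where "d = sqrt \<Delta>"
  define k where "k = (\<theta>' - lam') - (\<theta> - lam)"
  have d: "d > 0" "\<Delta> = d\<^sup>2" unfolding d_def using \<Delta> by auto
  have s1: "sqrt (2 * pi * \<sigma>'\<^sup>2 * \<Delta>) = sqrt (2 * pi) * \<sigma>' * d"
    unfolding d(2) using d(1) \<sigma>' by (simp add: real_sqrt_mult)
  have s2: "sqrt (2 * pi * (\<sigma>' / \<sigma>)\<^sup>2) = sqrt (2 * pi) * (\<sigma>' / \<sigma>)"
    using \<sigma> \<sigma>' by (simp add: real_sqrt_mult)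
  have summand: "exp (- lam' * \<Delta>) * (lam' * \<Delta>) ^ m / fact m * (1 / sqrt (2 * pi * \<sigma>'\<^sup>2 * \<Delta>))
      * exp (- (x + (\<theta> - lam) * \<Delta> + y - x - (\<theta>' - lam') * \<Delta> - real m)\<^sup>2 / (2 * \<sigma>'\<^sup>2 * \<Delta>)) =
      mixture_weight (\<sigma> * sqrt \<Delta>) (lam' * \<Delta>) (k * sqrt \<Delta> / \<sigma>) (\<sigma>' / \<sigma>) y m / (\<sigma> * sqrt \<Delta>)" for m
  proof -
    have "- (x + (\<theta> - lam) * \<Delta> + y - x - (\<theta>' - lam') * \<Delta> - real m)\<^sup>2 / (2 * \<sigma>'\<^sup>2 * \<Delta>) = - (y - real m - k * d\<^sup>2)\<^sup>2 / (2 * \<sigma>'\<^sup>2 * d\<^sup>2)"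
      unfolding k_def d(2) by (simp add: algebra_simps)
    also have "\<dots> = - ((y - real m) / (\<sigma> * d) - k * d / \<sigma>)\<^sup>2 / (2 * (\<sigma>' / \<sigma>)\<^sup>2)"
    proof -
      have "(y - real m) / (\<sigma> * d) - k * d / \<sigma> = (y - real m - k * d\<^sup>2) / (\<sigma> * d)"
        using \<sigma> d(1) by (simp add: field_simps power2_eq_square)
      thus ?thesis using \<sigma> d(1) \<sigma>' by (simp add: power_divide power_mult_distrib)
    qed
    finally have ex: "- (x + (\<theta> - lam) * \<Delta> + y - x - (\<theta>' - lam') * \<Delta> - real m)\<^sup>2 / (2 * \<sigma>'\<^sup>2 * \<Delta>) =
      - ((y - real m) / (\<sigma> * d) - k * d / \<sigma>)\<^sup>2 / (2 * (\<sigma>' / \<sigma>)\<^sup>2)" .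
    show ?thesis
      unfolding ex mixture_weight_def normal_density_def d_def[symmetric] s1 s2
      using \<sigma> \<sigma>' d(1) by simp
  qed
  have "summable (mixture_weight (\<sigma> * sqrt \<Delta>) (lam' * \<Delta>) (k * sqrt \<Delta> / \<sigma>) (\<sigma>' / \<sigma>) y)"
    using assms by (intro summable_mixture_weight) auto
  from suminf_divide[OF this, of "\<sigma> * sqrt \<Delta>"] show ?thesis
    unfolding trans_dens_def summand mixture_density_def k_def .
qed

section \<open>Law and independence of the observed increments\<close>

lemma normal_distribution_eq_distr:
  assumes "c > 0"
  shows "density lborel (normal_density 0 c) = distr std_normal_distribution borel (\<lambda>g. c * g)"
proof -
  interpret N: prob_space std_normal_distribution by (rule prob_space_std_normal)
  have "distr std_normal_distribution lborel (\<lambda>x. x) = distr std_normal_distribution std_normal_distribution (\<lambda>x. x)"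
    by (rule distr_cong) auto
  also have "\<dots> = std_normal_distribution" by (rule distr_id)
  finally have "distributed std_normal_distribution lborel (\<lambda>x. x) (normal_density 0 1)"
    unfolding distributed_def by simp
  from N.normal_density_affine[OF this, of c 0] assms
  have "distributed std_normal_distribution lborel (\<lambda>x. c * x) (normal_density 0 c)" by simp
  hence "distr std_normal_distribution lborel (\<lambda>x. c * x) = density lborel (normal_density 0 c)"
    by (simp add: distributed_def)
  thus ?thesis by (metis distr_cong sets_lborel)
qed

text \<open>\<open>K\<close> is real-valued and a natural number only almost surely. It is replaced
  by the version \<open>K'\<close>, whose law on a countable space is determined by its point
  masses.\<close>

lemma (in prob_space) distr_eq_poisson:
  fixes K :: "'a \<Rightarrow> real"
  assumes [measurable]: "K \<in> borel_measurable M" and nat: "AE \<omega> in M. K \<omega> \<in> \<nat>" and \<mu>: "\<mu> > 0"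
    and pm: "\<And>k. prob {\<omega> \<in> space M. K \<omega> = real k} = \<mu> ^ k / fact k * exp (- \<mu>)"
  shows "distr M borel K = distr (measure_pmf (poisson_pmf \<mu>)) borel real"
proof -
  define K' where "K' \<omega> = nat \<lfloor>K \<omega>\<rfloor>" for \<omega>
  have [measurable]: "K' \<in> measurable M (count_space UNIV)" unfolding K'_def by measurable
  have ae: "AE \<omega> in M. K \<omega> = real (K' \<omega>)"
    using nat by eventually_elim (auto simp: K'_def elim!: Nats_cases)
  have "distr M (count_space UNIV) K' = measure_pmf (poisson_pmf \<mu>)"
  proof (rule measure_eqI_countable[where A=UNIV])
    fix k :: nat
    have "emeasure (distr M (count_space UNIV) K') {k} = emeasure M {\<omega> \<in> space M. K' \<omega> = k}"
      by (subst emeasure_distr) (auto intro!: arg_cong2[where f=emeasure])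
    also have "\<dots> = emeasure M {\<omega> \<in> space M. K \<omega> = real k}"
      by (rule emeasure_eq_AE) (use ae in eventually_elim, auto)
    also have "\<dots> = ennreal (pmf (poisson_pmf \<mu>) k)"
      using \<mu> by (simp add: emeasure_eq_measure pm)
    finally show "emeasure (distr M (count_space UNIV) K') {k} = emeasure (measure_pmf (poisson_pmf \<mu>)) {k}"
      by (simp add: emeasure_pmf_single)
  qed auto
  moreover have "distr M borel K = distr M borel (\<lambda>\<omega>. real (K' \<omega>))"
    by (rule distr_cong_AE) (use ae in auto)
  moreover have "distr (distr M (count_space UNIV) K') borel real = distr M borel (\<lambda>\<omega>. real (K' \<omega>))"
    by (subst distr_distr) (auto simp: comp_def)
  ultimately show ?thesis by simp
qed

lemma (in prob_space) indep_vars_imp_indep_var: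
  assumes "indep_vars (\<lambda>_. borel) X I" "i \<in> I" "j \<in> I" "i \<noteq> j"
  shows "indep_var borel (X i) borel (X j :: 'a \<Rightarrow> real)"
proof -
  have "indep_var (PiM {i} (\<lambda>_. borel)) (\<lambda>\<omega>. restrict (\<lambda>i. X i \<omega>) {i}) (PiM {j} (\<lambda>_. borel)) (\<lambda>\<omega>. restrict (\<lambda>i. X i \<omega>) {j})"
    using assms by (intro indep_var_restrict) auto
  from indep_var_compose[OF this, of "\<lambda>f. f i" borel "\<lambda>f. f j" borel]
  show ?thesis by (simp add: comp_def)
qed

lemma bm_poisson_increment_law:
  assumes bp: "bm_poisson M B N lam" and lam: "lam > 0" and st: "0 \<le> s" "s < t"
  shows "distr M borel (\<lambda>\<omega>. \<sigma> * (B t \<omega> - B s \<omega>) + (N t \<omega> - N s \<omega>)) =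
    distr (complete_law (lam * (t - s))) borel (\<lambda>z. \<sigma> * sqrt (t - s) * fst z + real (snd z))"
proof -
  let ?\<mu> = "lam * (t - s)"
  let ?B = "\<lambda>\<omega>. B t \<omega> - B s \<omega>" and ?N = "\<lambda>\<omega>. N t \<omega> - N s \<omega>"
  interpret prob_space M using bp by (simp add: bm_poisson_def)
  interpret S: prob_space std_normal_distribution by (rule prob_space_std_normal)
  have [measurable]: "B t \<in> borel_measurable M" "N t \<in> borel_measurable M" for t
    using bp by (auto simp: bm_poisson_def)
  have \<mu>: "?\<mu> > 0" using lam st by simp
  have dB: "distr M borel ?B = distr std_normal_distribution borel (\<lambda>g. sqrt (t - s) * g)"
    using bp st by (subst normal_distribution_eq_distr[symmetric]) (auto simp: bm_poisson_def)
  have mono: "AE \<omega> in M. (\<forall>t\<ge>0. N t \<omega> \<in> \<nat>) \<and> mono_on {0..} (\<lambda>t. N t \<omega>)"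
    using bp unfolding bm_poisson_def by (auto elim!: eventually_mono)
  have dN: "distr M borel ?N = distr (measure_pmf (poisson_pmf ?\<mu>)) borel real"
  proof (rule distr_eq_poisson)
    show "AE \<omega> in M. ?N \<omega> \<in> \<nat>" using mono
    proof eventually_elim
      case (elim \<omega>)
      \<comment> \<open>Monotonicity is what makes the difference of two natural numbers again a
        natural number.\<close>
      have "N s \<omega> \<le> N t \<omega>" using elim st by (auto simp: mono_on_def)
      moreover have "N s \<omega> \<in> \<nat>" "N t \<omega> \<in> \<nat>" using elim st by auto
      ultimately show ?case by (metis Nats_cases Nats_diff of_nat_in_Nats of_nat_le_iff of_nat_diff)
    qed
    show "prob {\<omega> \<in> space M. ?N \<omega> = real k} = ?\<mu> ^ k / fact k * exp (- ?\<mu>)" for k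
      using bp st by (auto simp: bm_poisson_def)
  qed (use \<mu> in auto)
  \<comment> \<open>A grid with the single step from s to t; independence over the index set {Inl 0,
    Inr 0} is that of the Brownian and the Poisson increment.\<close>
  define ts :: "nat \<Rightarrow> real" where "ts i = (if i = 0 then s else t)" for i
  have "indep_vars (\<lambda>_. borel) (\<lambda>j. case j of Inl i \<Rightarrow> (\<lambda>\<omega>. B (ts (Suc i)) \<omega> - B (ts i) \<omega>)
      | Inr i \<Rightarrow> (\<lambda>\<omega>. N (ts (Suc i)) \<omega> - N (ts i) \<omega>)) ({..<1} <+> {..<1})"
    using bp st unfolding bm_poisson_def by (auto simp: ts_def)
  from indep_vars_imp_indep_var[OF this InlI InrI, of 0 0]
  have "indep_var borel ?B borel ?N" by (simp add: ts_def)
  hence "distr M (borel \<Otimes>\<^sub>M borel) (\<lambda>\<omega>. (?B \<omega>, ?N \<omega>)) = distr M borel ?B \<Otimes>\<^sub>M distr M borel ?N"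
    by (simp add: indep_var_distribution_eq)
  also have "\<dots> = distr std_normal_distribution borel (\<lambda>g. sqrt (t - s) * g) \<Otimes>\<^sub>M distr (measure_pmf (poisson_pmf ?\<mu>)) borel real"
    unfolding dB dN ..
  also have "\<dots> = distr (complete_law ?\<mu>) (borel \<Otimes>\<^sub>M borel) (\<lambda>(g, m). (sqrt (t - s) * g, real m))"
    unfolding complete_law_def
    by (rule pair_measure_distr)
       (auto intro!: prob_space_imp_sigma_finite measure_pmf.prob_space_distr)
  finally have pair: "distr M (borel \<Otimes>\<^sub>M borel) (\<lambda>\<omega>. (?B \<omega>, ?N \<omega>)) = distr (complete_law ?\<mu>) (borel \<Otimes>\<^sub>M borel) (\<lambda>(g, m). (sqrt (t - s) * g, real m))" .
  have "distr M borel (\<lambda>\<omega>. \<sigma> * ?B \<omega> + ?N \<omega>) = distr (distr M (borel \<Otimes>\<^sub>M borel) (\<lambda>\<omega>. (?B \<omega>, ?N \<omega>))) borel (\<lambda>p. \<sigma> * fst p + snd p)"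
    by (subst distr_distr) (auto simp: comp_def)
  also have "\<dots> = distr (complete_law ?\<mu>) borel (\<lambda>z. \<sigma> * sqrt (t - s) * fst z + real (snd z))"
    unfolding pair by (subst distr_distr) (auto simp: comp_def case_prod_beta' mult.assoc)
  finally show ?thesis .
qed

lemma bm_poisson_indep_increments:
  assumes bp: "bm_poisson M B N lam" and \<Delta>: "\<Delta> > 0"
  shows "prob_space.indep_vars M (\<lambda>_. borel)
    (\<lambda>k \<omega>. \<sigma> * (B (real (Suc k) * \<Delta>) \<omega> - B (real k * \<Delta>) \<omega>) + (N (real (Suc k) * \<Delta>) \<omega> - N (real k * \<Delta>) \<omega>)) {..<n}"
proof -
  interpret prob_space M using bp by (simp add: bm_poisson_def)
  let ?X = "\<lambda>j. case j of Inl i \<Rightarrow> (\<lambda>\<omega>. B (real (Suc i) * \<Delta>) \<omega> - B (real i * \<Delta>) \<omega>)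
      | Inr i \<Rightarrow> (\<lambda>\<omega>. N (real (Suc i) * \<Delta>) \<omega> - N (real i * \<Delta>) \<omega>)"
  have "\<forall>(ts :: nat \<Rightarrow> real) m. 0 \<le> ts 0 \<and> (\<forall>i<m. ts i < ts (Suc i)) \<longrightarrow>
        indep_vars (\<lambda>_. borel)
          (\<lambda>j. case j of
                 Inl i \<Rightarrow> (\<lambda>\<omega>. B (ts (Suc i)) \<omega> - B (ts i) \<omega>)
               | Inr i \<Rightarrow> (\<lambda>\<omega>. N (ts (Suc i)) \<omega> - N (ts i) \<omega>))
          ({..<m} <+> {..<m})"
    using bp unfolding bm_poisson_def by blast
  hence "indep_vars (\<lambda>_. borel) ?X ({..<n} <+> {..<n})"
    by (elim allE[of _ "\<lambda>k. real k * \<Delta>"] allE[of _ n] impE) (use \<Delta> in simp_all)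
  \<comment> \<open>The two families of increments are regrouped into disjoint blocks, one for each
    observation interval.\<close>
  hence "indep_vars (\<lambda>k. PiM {Inl k, Inr k} (\<lambda>_. borel)) (\<lambda>k \<omega>. restrict (\<lambda>i. ?X i \<omega>) {Inl k, Inr k}) {..<n}"
    by (rule indep_vars_restrict) (auto simp: disjoint_family_on_def)
  hence "indep_vars (\<lambda>_. borel) (\<lambda>k \<omega>. (\<lambda>f. \<sigma> * f (Inl k) + f (Inr k)) (restrict (\<lambda>i. ?X i \<omega>) {Inl k, Inr k})) {..<n}"
    by (rule indep_vars_compose2) measurable
  thus ?thesis by simp
qed

theorem theorem1:
  fixes M :: "'a measure" and B N :: "real \<Rightarrow> 'a \<Rightarrow> real"
    and \<Delta> :: "nat \<Rightarrow> real" and x \<theta> \<sigma> lam u v w :: real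
  assumes "\<forall>n. 0 < \<Delta> n \<and> \<Delta> n \<le> 1"
    and "\<Delta> \<longlonglongrightarrow> 0"
    and "filterlim (\<lambda>n. real n * \<Delta> n) at_top sequentially"
    and "\<sigma> > 0" and "lam > 0"
    and "bm_poisson M B N lam"
  defines "X \<equiv> (\<lambda>t \<omega>. x + \<theta> * t + \<sigma> * B t \<omega> + N t \<omega> - lam * t)"
    and "\<theta>n \<equiv> (\<lambda>n::nat. \<theta> + u / sqrt (real n * \<Delta> n))"
    and "\<sigma>n \<equiv> (\<lambda>n::nat. \<sigma> + v / sqrt (real n))"
    and "lamn \<equiv> (\<lambda>n::nat. lam + w / sqrt (real n * \<Delta> n))"
  shows "weak_conv_m
           (\<lambda>n. distr M borel (\<lambda>\<omega>.
              ln (likelihood (\<theta>n n) (\<sigma>n n) (lamn n) (\<Delta> n) n (\<lambda>k. X (real k * \<Delta> n) \<omega>)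
                  / likelihood \<theta> \<sigma> lam (\<Delta> n) n (\<lambda>k. X (real k * \<Delta> n) \<omega>))))
           (lan_limit_law (quad_form (Fisher \<sigma> lam) (\<lambda>i. if i = 0 then u else if i = 1 then v else w)))"
proof -
  \<comment> \<open>\<open>q\<close> is the Fisher form written as a sum of squares, ((u - w)^2 + 2
    v^2) / \<sigma>^2 + w^2 / \<lambda>; u - w is the change of the drift parameter \<theta> -
    \<lambda> in units of 1 / sqrt (n \<Delta>).\<close>
  define a b q where "a = (u - w) / \<sigma>" and "b = v / \<sigma>" and "q = a\<^sup>2 + 2 * b\<^sup>2 + w\<^sup>2 / lam"
  define Y where "Y n k \<omega> = \<sigma> * (B (real (Suc k) * \<Delta> n) \<omega> - B (real k * \<Delta> n) \<omega>) + (N (real (Suc k) * \<Delta> n) \<omega> - N (real k * \<Delta> n) \<omega>)" for n k \<omega>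
  define r where "r n y = mixture_density (\<sigma> * sqrt (\<Delta> n)) ((lam + w / sqrt (real n * \<Delta> n)) * \<Delta> n) (a / sqrt (real n)) (1 + b / sqrt (real n)) y
      / mixture_density (\<sigma> * sqrt (\<Delta> n)) (lam * \<Delta> n) 0 1 y" for n y
  define L where "L n \<omega> = ln (likelihood (\<theta>n n) (\<sigma>n n) (lamn n) (\<Delta> n) n (\<lambda>k. X (real k * \<Delta> n) \<omega>)
                  / likelihood \<theta> \<sigma> lam (\<Delta> n) n (\<lambda>k. X (real k * \<Delta> n) \<omega>))" for n \<omega>
  have \<Delta>: "\<Delta> n > 0" for n using assms(1) by blast
  note \<sigma> = assms(4) and lam = assms(5) and bp = assms(6)
  interpret prob_space M using bp by (simp add: bm_poisson_def)
  have [measurable]: "B t \<in> borel_measurable M" "N t \<in> borel_measurable M" for t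
    using bp by (auto simp: bm_poisson_def)
  have [measurable]: "r n \<in> borel_measurable borel" for n unfolding r_def by measurable
  have L_meas [measurable]: "L n \<in> borel_measurable M" for n
    unfolding L_def likelihood_def trans_dens_def X_def by measurable
  have q: "quad_form (Fisher \<sigma> lam) (\<lambda>i. if i = 0 then u else if i = 1 then v else w) = q"
    unfolding quad_form_def Fisher_def q_def a_def b_def using \<sigma> lam
    by (simp add: eval_nat_numeral field_simps)
  have q0: "q \<ge> 0" unfolding q_def using lam by simp
  have lamn: "lamn \<longlonglongrightarrow> lam + 0"
    unfolding lamn_def
    by (intro tendsto_add tendsto_const real_tendsto_divide_at_top[OF tendsto_const filterlim_compose[OF sqrt_at_top assms(3)]])
  have \<sigma>n: "\<sigma>n \<longlonglongrightarrow> \<sigma> + 0"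
    unfolding \<sigma>n_def
    by (intro tendsto_add tendsto_const real_tendsto_divide_at_top[OF tendsto_const filterlim_compose[OF sqrt_at_top filterlim_real_sequentially]])
  \<comment> \<open>For small n the perturbed volatility or intensity may fail to be positive, and
    the formula for the likelihood is then no longer that of a density; the factorisation below is
    therefore only an eventual one.\<close>
  have ev: "\<forall>\<^sub>F n in sequentially. n > 0 \<and> lamn n > 0 \<and> \<sigma>n n > 0"
    using eventually_gt_at_top[of 0] order_tendstoD(1)[OF lamn, of 0] order_tendstoD(1)[OF \<sigma>n, of 0] \<sigma> lam
    by (auto elim: eventually_elim2 intro: eventually_conj)
  have L_sum: "L n \<omega> = (\<Sum>k<n. ln (r n (Y n k \<omega>)))" if n: "n > 0" "lamn n > 0" "\<sigma>n n > 0" for n \<omega>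
  proof -
    let ?D = "\<Delta> n" and ?\<tau> = "\<sigma> * sqrt (\<Delta> n)"
    have step: "X (real (Suc k) * ?D) \<omega> = X (real k * ?D) \<omega> + (\<theta> - lam) * ?D + Y n k \<omega>" for k
      unfolding X_def Y_def by (simp add: algebra_simps)
    have shift: "((\<theta>n n - lamn n) - (\<theta> - lam)) * sqrt ?D / \<sigma> = a / sqrt (real n)"
      unfolding \<theta>n_def lamn_def a_def using \<sigma> n(1) \<Delta>[of n]
      by (simp add: real_sqrt_mult field_simps)
    have scale: "\<sigma>n n / \<sigma> = 1 + b / sqrt (real n)"
      unfolding \<sigma>n_def b_def using \<sigma> n(1) by (simp add: field_simps)
    have num: "trans_dens (\<theta>n n) (\<sigma>n n) (lamn n) ?D (X (real k * ?D) \<omega>) (X (real (Suc k) * ?D) \<omega>) =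
        mixture_density ?\<tau> (lamn n * ?D) (a / sqrt (real n)) (1 + b / sqrt (real n)) (Y n k \<omega>) / ?\<tau>" for k
      unfolding step trans_dens_eq_mixture_density[OF \<sigma> n(3,2) \<Delta>] shift scale ..
    have den: "trans_dens \<theta> \<sigma> lam ?D (X (real k * ?D) \<omega>) (X (real (Suc k) * ?D) \<omega>) =
        mixture_density ?\<tau> (lam * ?D) 0 1 (Y n k \<omega>) / ?\<tau>" for k
      unfolding step trans_dens_eq_mixture_density[OF \<sigma> \<sigma> lam \<Delta>] using \<sigma> by simp
    have pos: "mixture_density ?\<tau> (lamn n * ?D) (a / sqrt (real n)) (1 + b / sqrt (real n)) y > 0"
        "mixture_density ?\<tau> (lam * ?D) 0 1 y > 0" for y
      using n lam \<sigma> \<Delta>[of n] unfolding scale[symmetric] by (auto intro!: mixture_density_pos)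
    have r: "r n y = mixture_density ?\<tau> (lamn n * ?D) (a / sqrt (real n)) (1 + b / sqrt (real n)) y / mixture_density ?\<tau> (lam * ?D) 0 1 y" for y
      unfolding r_def lamn_def ..
    have rpos: "r n y > 0" for y unfolding r using pos by simp
    have cancel: "(p / ?\<tau>) / (p' / ?\<tau>) = p / p'" for p p'
      using \<sigma> \<Delta>[of n] by simp
    have "L n \<omega> = ln (\<Prod>k<n. r n (Y n k \<omega>))"
      unfolding L_def likelihood_def num den prod_dividef[symmetric] r cancel ..
    also have "\<dots> = (\<Sum>k<n. ln (r n (Y n k \<omega>)))"
      using rpos by (intro ln_prod) (auto simp: rpos[THEN less_imp_neq, THEN not_sym])
    finally show ?thesis .
  qed
  have Y_law: "distr M borel (Y n k) = distr (complete_law (lam * \<Delta> n)) borel (\<lambda>z. \<sigma> * sqrt (\<Delta> n) * fst z + real (snd z))" for n k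
  proof -
    have "real (Suc k) * \<Delta> n - real k * \<Delta> n = \<Delta> n" by (simp add: algebra_simps)
    moreover have "0 \<le> real k * \<Delta> n" "real k * \<Delta> n < real (Suc k) * \<Delta> n" using \<Delta>[of n] by auto
    ultimately show ?thesis
      unfolding Y_def using bm_poisson_increment_law[OF bp lam, of "real k * \<Delta> n" "real (Suc k) * \<Delta> n" \<sigma>] by simp
  qed
  have Y_meas [measurable]: "Y n k \<in> borel_measurable M" for n k unfolding Y_def by measurable
  have "weak_conv_m (\<lambda>n. distr M borel (L n)) (lan_limit_law q)"
  proof (rule levy_continuity)
    show "real_distribution (distr M borel (L n))" for n by (rule real_distribution_distr) measurable
    show "real_distribution (lan_limit_law q)"
      unfolding lan_limit_law_def by (rule prob_space.real_distribution_distr[OF prob_space_std_normal]) measurable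
    fix t :: real
    define \<phi> where "\<phi> n = (CLINT z|complete_law (lam * \<Delta> n). iexp (t * ln (r n (\<sigma> * sqrt (\<Delta> n) * fst z + real (snd z)))))" for n
    \<comment> \<open>\<phi> n is free of k because the increments of row n are identically
      distributed; with independence the characteristic function of the sum is an n-th
      power.\<close>
    have \<phi>: "char (distr M borel (\<lambda>\<omega>. ln (r n (Y n k \<omega>)))) t = \<phi> n" for n k
    proof -
      have "char (distr M borel (\<lambda>\<omega>. ln (r n (Y n k \<omega>)))) t = (CLINT \<omega>|M. iexp (t * ln (r n (Y n k \<omega>))))"
        unfolding char_def by (rule integral_distr) measurable
      also have "\<dots> = (CLINT y|distr M borel (Y n k). iexp (t * ln (r n y)))"
        by (rule integral_distr[symmetric]) measurable
      also have "\<dots> = \<phi> n"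
        unfolding Y_law \<phi>_def by (rule integral_distr) measurable
      finally show ?thesis .
    qed
    have "(\<lambda>n. of_nat n * (\<phi> n - 1)) \<longlonglongrightarrow> - (of_real (t\<^sup>2) + \<i> * of_real t) / 2 * of_real q"
      unfolding \<phi>_def q_def r_def by (rule row_char_asymptotics[OF \<Delta> assms(2,3) \<sigma> lam])
    \<comment> \<open>This holds for every n, even where \<open>r\<close> might fail to be positive:
      \<open>ln\<close> is total and measurable, so \<phi> n is still a value of a characteristic
      function.\<close>
    moreover have "\<forall>\<^sub>F n in sequentially. cmod (\<phi> n) \<le> 1"
    proof (rule always_eventually, rule allI)
      fix n
      interpret D: real_distribution "distr M borel (\<lambda>\<omega>. ln (r n (Y n 0 \<omega>)))"
        by (rule real_distribution_distr) measurable
      show "cmod (\<phi> n) \<le> 1" using D.cmod_char_le_1[of t] unfolding \<phi> .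
    qed
    moreover have "Re (- (of_real (t\<^sup>2) + \<i> * of_real t) / 2 * of_real q) \<le> 0" using q0 by simp
    ultimately have "(\<lambda>n. \<phi> n ^ n) \<longlonglongrightarrow> char (lan_limit_law q) t"
      unfolding char_lan_limit_law[OF q0] by (intro power_tendsto_exp)
    moreover have "\<forall>\<^sub>F n in sequentially. \<phi> n ^ n = char (distr M borel (L n)) t"
      using ev
    proof eventually_elim
      case (elim n)
      have "indep_vars (\<lambda>_. borel) (Y n) {..<n}"
        using bm_poisson_indep_increments[OF bp \<Delta>[of n], of \<sigma> n] unfolding Y_def[abs_def] .
      hence "indep_vars (\<lambda>_. borel) (\<lambda>k \<omega>. ln (r n (Y n k \<omega>))) {..<n}"
        by (rule indep_vars_compose2) measurable
      from char_distr_sum[OF this, of t] have "char (distr M borel (\<lambda>\<omega>. \<Sum>k<n. ln (r n (Y n k \<omega>)))) t = \<phi> n ^ n"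
        by (simp add: \<phi>)
      moreover have "L n = (\<lambda>\<omega>. \<Sum>k<n. ln (r n (Y n k \<omega>)))" using elim L_sum by blast
      ultimately show ?case by simp
    qed
    ultimately show "(\<lambda>n. char (distr M borel (L n)) t) \<longlonglongrightarrow> char (lan_limit_law q) t"
      by (rule Lim_transform_eventually)
  qed
  thus ?thesis unfolding q L_def .
qed

end
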